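(* Let $k$ be a field of characteristic zero, $R=k[x_1,\ldots,x_n]$, let $\mathbf f=f_1,\ldots,f_m\in R$ be forms, $A=k[\mathbf f]\subset R$, and $A\simeq k[T_1,\ldots,T_m]/P$ via $T_j\mapsto f_j$. The following conditions are equivalent: (i) $P/P^{(2)}$ is contracted from $\mathfrak{Z}$, i.e. $\delta(P/P^{(2)})=\mathfrak{Z}\cap\sum_{j=1}^m A\,dT_j$; (ii) the Leibniz map $\lambda:\Omega_{A/k}\to\mathcal{D}(\mathbf f)$ is injective; (iii) $\Omega_{A/k}$ is a torsion free $A$-module. Moreover, any of these conditions implies that $P/P^{(2)}$ is a reflexive $A$-module. In particular, if $P/P^{(2)}$ is the contraction of its $R$-extension $\mathfrak{D}$ (i.e. $\delta(P/P^{(2)})=\mathfrak{D}\cap\sum_{j=1}^m A\,dT_j$) and if $\mathbf f$ is polarizable, then $P/P^{(2)}$ is a reflexive $A$-module.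
   Context: $P^{(2)}$ is the second symbolic power of the prime ideal $P$. $\sum_j A\,dT_j\subset\sum_j R\,dT_j$ are the free modules over $A$ and $R$ with basis $dT_1,\ldots,dT_m$. $\delta:P/P^{(2)}\to\sum_j A\,dT_j$ is the injective $A$-linear map sending the class of $F\in P$ to $\sum_j\frac{\partial F}{\partial T_j}(\mathbf f)\,dT_j$; its cokernel is the module $\Omega_{A/k}$ of K\"ahler $k$-differentials. For $f\in R$ put $df=\sum_{i=1}^n\frac{\partial f}{\partial x_i}dx_i\in\sum_{i=1}^n R\,dx_i$ (free $R$-module). The transposed Jacobian module is $\mathcal{D}(\mathbf f)=\sum_{j=1}^m R\,df_j$. The differential syzygy module $\mathfrak{Z}$ is the kernel of the $R$-linear map $\sum_j R\,dT_j\to\mathcal{D}(\mathbf f)$, $dT_j\mapsto df_j$. The polar syzygy module $\mathfrak{D}$ is the $R$-submodule of $\sum_j R\,dT_j$ generated by $\delta(P/P^{(2)})$; one has $\mathfrak{D}\subset\mathfrak{Z}$ by the chain rule. $\mathbf f$ is polarizable if $\mathfrak{D}=\mathfrak{Z}$. The Leibniz map $\lambda:\Omega_{A/k}\to\mathcal{D}(\mathbf f)$ is the $A$-linear map induced by the assignment $dT_j\mapsto df_j$ on $\sum_j A\,dT_j$ (well defined by the chain rule). *)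

theory Defs
  imports "HOL-Algebra.Module" "HOL-Algebra.QuotRing" "HOL-Algebra.Ideal_Product" "HOL-Library.Poly_Mapping"
begin

section \<open>Polynomials\<close>

text \<open>Exponent vectors are finitely supported functions on the variables, polynomials are finitely
  supported functions on exponent vectors; multiplication is convolution. The tuple
  $x_1,\ldots,x_n$ is indexed by a finite linearly ordered type with $n$ elements; the order on the variables
  only serves to make the polynomials an instance of \<open>idom\<close>.\<close>

type_synonym ('v, 'k) mpoly = "('v \<Rightarrow>\<^sub>0 nat) \<Rightarrow>\<^sub>0 'k"

definition is_form :: "('v::finite, 'k::zero) mpoly \<Rightarrow> bool" where
  "is_form p \<longleftrightarrow> (\<exists>d. \<forall>t\<in>Poly_Mapping.keys p. (\<Sum>v\<in>UNIV. Poly_Mapping.lookup t v) = d)"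

definition subst :: "('m::finite \<Rightarrow> ('n, 'k::comm_ring_1) mpoly) \<Rightarrow> ('m, 'k) mpoly \<Rightarrow> ('n, 'k) mpoly" where
  "subst f F = (\<Sum>t\<in>Poly_Mapping.keys F. Poly_Mapping.single 0 (Poly_Mapping.lookup F t) * (\<Prod>j\<in>UNIV. f j ^ Poly_Mapping.lookup t j))"

text \<open>If \<open>Poly_Mapping.lookup t v = 0\<close> the truncated difference \<open>t - Poly_Mapping.single v 1\<close> is irrelevant, as its
  coefficient vanishes.\<close>

definition pd :: "'v \<Rightarrow> ('v, 'k::comm_ring_1) mpoly \<Rightarrow> ('v, 'k) mpoly" where
  "pd v F = (\<Sum>t\<in>Poly_Mapping.keys F. Poly_Mapping.single (t - Poly_Mapping.single v 1) (of_nat (Poly_Mapping.lookup t v) * Poly_Mapping.lookup F t))"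

definition grad :: "('n, 'k::comm_ring_1) mpoly \<Rightarrow> 'n \<Rightarrow> ('n, 'k) mpoly" where
  "grad p = (\<lambda>i. pd i p)"

section \<open>Rings and modules\<close>

definition class_ring :: "'a::comm_ring_1 set \<Rightarrow> 'a ring" where
  "class_ring S = \<lparr>carrier = S, mult = (*), one = 1, zero = 0, add = (+)\<rparr>"

text \<open>For a prime \<open>P\<close> this is the contraction of $P^r R_P$ to \<open>R\<close>; the power of \<open>P\<close> is taken in the
  monoid of ideals.\<close>

definition symbolic_power :: "('a, 'b) ring_scheme \<Rightarrow> 'a set \<Rightarrow> nat \<Rightarrow> 'a set" where
  "symbolic_power R P r =
    {x \<in> carrier R. \<exists>s\<in>carrier R - P. s \<otimes>\<^bsub>R\<^esub> x \<in> P [^]\<^bsub>ideals_set R\<^esub> r}"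

definition free_module :: "('a, 'b) ring_scheme \<Rightarrow> ('a, 'i \<Rightarrow> 'a) module" where
  "free_module R = \<lparr>carrier = UNIV \<rightarrow> carrier R, mult = undefined, one = undefined,
    zero = (\<lambda>_. \<zero>\<^bsub>R\<^esub>), add = (\<lambda>v w i. v i \<oplus>\<^bsub>R\<^esub> w i), smult = (\<lambda>a v i. a \<otimes>\<^bsub>R\<^esub> v i)\<rparr>"

definition self_module :: "('a, 'b) ring_scheme \<Rightarrow> ('a, 'a) module" where
  "self_module R = \<lparr>carrier = carrier R, mult = mult R, one = one R,
    zero = zero R, add = add R, smult = mult R\<rparr>"

definition quotient_module :: "('a, 'b) module \<Rightarrow> 'b set \<Rightarrow> ('a, 'b set) module" where
  "quotient_module M N = \<lparr>carrier = a_rcosets\<^bsub>M\<^esub> N, mult = undefined, one = undefined,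
    zero = N, add = set_add M, smult = (\<lambda>a X. \<Union>x\<in>X. N +>\<^bsub>M\<^esub> (a \<odot>\<^bsub>M\<^esub> x))\<rparr>"

definition generated_submodule :: "('a, 'c) ring_scheme \<Rightarrow> ('a, 'b) module \<Rightarrow> 'b set \<Rightarrow> 'b set" where
  "generated_submodule R M X = \<Inter>{N. submodule N R M \<and> X \<subseteq> N}"

definition module_hom :: "('a, 'd) ring_scheme \<Rightarrow> ('a, 'b) module \<Rightarrow> ('a, 'c) module \<Rightarrow> ('b \<Rightarrow> 'c) set" where
  "module_hom R M N = {h \<in> carrier M \<rightarrow> carrier N.
    (\<forall>x\<in>carrier M. \<forall>y\<in>carrier M. h (x \<oplus>\<^bsub>M\<^esub> y) = h x \<oplus>\<^bsub>N\<^esub> h y) \<and>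
    (\<forall>a\<in>carrier R. \<forall>x\<in>carrier M. h (a \<odot>\<^bsub>M\<^esub> x) = a \<odot>\<^bsub>N\<^esub> h x)}"

text \<open>Linear forms are made extensional, so that equal maps on the carrier are equal elements.\<close>

definition dual_module :: "('a, 'd) ring_scheme \<Rightarrow> ('a, 'b) module \<Rightarrow> ('a, 'b \<Rightarrow> 'a) module" where
  "dual_module R M = \<lparr>carrier = module_hom R M (self_module R) \<inter> extensional (carrier M),
    mult = undefined, one = undefined,
    zero = (\<lambda>x\<in>carrier M. \<zero>\<^bsub>R\<^esub>), add = (\<lambda>\<phi> \<psi>. \<lambda>x\<in>carrier M. \<phi> x \<oplus>\<^bsub>R\<^esub> \<psi> x),
    smult = (\<lambda>a \<phi>. \<lambda>x\<in>carrier M. a \<otimes>\<^bsub>R\<^esub> \<phi> x)\<rparr>"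

definition reflexive :: "('a, 'd) ring_scheme \<Rightarrow> ('a, 'b) module \<Rightarrow> bool" where
  "reflexive R M \<longleftrightarrow> bij_betw (\<lambda>x. \<lambda>\<phi>\<in>carrier (dual_module R M). \<phi> x)
     (carrier M) (carrier (dual_module R (dual_module R M)))"

text \<open>This is the usual notion when \<open>R\<close> is an integral domain.\<close>

definition torsion_free :: "('a, 'd) ring_scheme \<Rightarrow> ('a, 'b) module \<Rightarrow> bool" where
  "torsion_free R M \<longleftrightarrow> (\<forall>a\<in>carrier R. \<forall>x\<in>carrier M. a \<odot>\<^bsub>M\<^esub> x = \<zero>\<^bsub>M\<^esub> \<longrightarrow> a = \<zero>\<^bsub>R\<^esub> \<or> x = \<zero>\<^bsub>M\<^esub>)"

section \<open>The modules attached to a tuple of polynomials\<close>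

abbreviation poly_ring :: "('v, 'k::comm_ring_1) mpoly ring" where
  "poly_ring \<equiv> class_ring UNIV"

text \<open>The algebra $A = k[\mathbf f]$ and the ideal $P$ with $k[\mathbf T]/P \simeq A$.\<close>

definition subalg :: "('m::finite \<Rightarrow> ('n, 'k::comm_ring_1) mpoly) \<Rightarrow> ('n, 'k) mpoly ring" where
  "subalg f = class_ring (range (subst f))"

definition rel_ideal :: "('m::finite \<Rightarrow> ('n, 'k::comm_ring_1) mpoly) \<Rightarrow> ('m, 'k) mpoly set" where
  "rel_ideal f = {F. subst f F = 0}"

abbreviation rel_ideal2 :: "('m::finite \<Rightarrow> ('n, 'k::comm_ring_1) mpoly) \<Rightarrow> ('m, 'k) mpoly set" where
  "rel_ideal2 f \<equiv> symbolic_power poly_ring (rel_ideal f) 2"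

text \<open>$P/P^{(2)}$ as an \<open>A\<close>-module: $a = G(\mathbf f)$ acts on the class of \<open>F\<close> through the class
  of \<open>G * F\<close>, see \<open>conormal_smult\<close> below.\<close>

definition conormal :: "('m::finite \<Rightarrow> ('n, 'k::comm_ring_1) mpoly) \<Rightarrow> (('n, 'k) mpoly, ('m, 'k) mpoly set) module" where
  "conormal f = \<lparr>carrier = a_rcosets\<^bsub>poly_ring\<lparr>carrier := rel_ideal f\<rparr>\<^esub> (rel_ideal2 f),
     mult = undefined, one = undefined, zero = rel_ideal2 f, add = set_add poly_ring,
     smult = (\<lambda>a X. \<Union>G\<in>{G. subst f G = a}. \<Union>F\<in>X. rel_ideal2 f +>\<^bsub>poly_ring\<^esub> (G * F))\<rparr>"

text \<open>The vector \<open>v\<close> stands for $\sum_j v_j\,dT_j$. On classes the maps \<open>delta\<close> and \<open>leibniz\<close> are the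
  common value on all representatives, see \<open>delta_coset\<close> and \<open>leibniz_coset\<close> below.\<close>

definition delta_rep :: "('m::finite \<Rightarrow> ('n, 'k::comm_ring_1) mpoly) \<Rightarrow> ('m, 'k) mpoly \<Rightarrow> 'm \<Rightarrow> ('n, 'k) mpoly" where
  "delta_rep f F = (\<lambda>j. subst f (pd j F))"

definition delta :: "('m::finite \<Rightarrow> ('n, 'k::comm_ring_1) mpoly) \<Rightarrow> ('m, 'k) mpoly set \<Rightarrow> 'm \<Rightarrow> ('n, 'k) mpoly" where
  "delta f X = the_elem (delta_rep f ` X)"

text \<open>$\Omega_{A/k}$ is the cokernel of \<open>delta\<close>; that it is the module of Kaehler differentials,
  with universal derivation \<open>univ_der\<close>, is shown in \<open>kaehler_universal\<close> below.\<close>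

definition kaehler :: "('m::finite \<Rightarrow> ('n, 'k::comm_ring_1) mpoly) \<Rightarrow> (('n, 'k) mpoly, ('m \<Rightarrow> ('n, 'k) mpoly) set) module" where
  "kaehler f = quotient_module (free_module (subalg f)) (delta f ` carrier (conormal f))"

definition jac_map :: "('m::finite \<Rightarrow> ('n, 'k::comm_ring_1) mpoly) \<Rightarrow> ('m \<Rightarrow> ('n, 'k) mpoly) \<Rightarrow> 'n \<Rightarrow> ('n, 'k) mpoly" where
  "jac_map f v = (\<lambda>i. \<Sum>j\<in>UNIV. v j * grad (f j) i)"

definition transposed_jacobian :: "('m::finite \<Rightarrow> ('n, 'k::comm_ring_1) mpoly) \<Rightarrow> (('n, 'k) mpoly, 'n \<Rightarrow> ('n, 'k) mpoly) module" where
  "transposed_jacobian f = (free_module poly_ring)\<lparr>carrier := range (jac_map f)\<rparr>"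

definition diff_syz :: "('m::finite \<Rightarrow> ('n, 'k::comm_ring_1) mpoly) \<Rightarrow> ('m \<Rightarrow> ('n, 'k) mpoly) set" where
  "diff_syz f = a_kernel (free_module poly_ring) (transposed_jacobian f) (jac_map f)"

definition polar_syz :: "('m::finite \<Rightarrow> ('n, 'k::comm_ring_1) mpoly) \<Rightarrow> ('m \<Rightarrow> ('n, 'k) mpoly) set" where
  "polar_syz f = generated_submodule poly_ring (free_module poly_ring) (delta f ` carrier (conormal f))"

definition polarizable :: "('m::finite \<Rightarrow> ('n, 'k::comm_ring_1) mpoly) \<Rightarrow> bool" where
  "polarizable f \<longleftrightarrow> polar_syz f = diff_syz f"

definition leibniz :: "('m::finite \<Rightarrow> ('n, 'k::comm_ring_1) mpoly) \<Rightarrow> ('m \<Rightarrow> ('n, 'k) mpoly) set \<Rightarrow> 'n \<Rightarrow> ('n, 'k) mpoly" where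
  "leibniz f X = the_elem (jac_map f ` X)"

section \<open>Substitution and partial derivatives\<close>

lemma mpoly_sum_single: "F = (\<Sum>t\<in>Poly_Mapping.keys F. Poly_Mapping.single t (Poly_Mapping.lookup F t))"
proof (rule poly_mapping_eqI)
  fix k
  have "Poly_Mapping.lookup (\<Sum>t\<in>Poly_Mapping.keys F. Poly_Mapping.single t (Poly_Mapping.lookup F t)) k
     = (\<Sum>t\<in>Poly_Mapping.keys F. if t = k then Poly_Mapping.lookup F t else 0)"
    by (simp add: lookup_sum lookup_single when_def)
  also have "\<dots> = Poly_Mapping.lookup F k"
    by (simp add: sum.delta in_keys_iff)
  finally show "Poly_Mapping.lookup F k = Poly_Mapping.lookup (\<Sum>t\<in>Poly_Mapping.keys F. Poly_Mapping.single t (Poly_Mapping.lookup F t)) k" ..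
qed

lemma mpoly_add_induct [case_names single add]:
  assumes "\<And>t c. Q (Poly_Mapping.single t c)" "\<And>F G. Q F \<Longrightarrow> Q G \<Longrightarrow> Q (F + G)"
  shows "Q (F :: 'a \<Rightarrow>\<^sub>0 'b::comm_monoid_add)"
proof -
  have "finite I \<Longrightarrow> Q (\<Sum>t\<in>I. Poly_Mapping.single t (Poly_Mapping.lookup F t))" for I
  proof (induction I rule: finite_induct)
    case empty
    show ?case using assms(1)[of undefined 0] by simp
  qed (simp add: assms)
  from this[OF finite_keys, of F] show ?thesis
    using mpoly_sum_single[of F] by simp
qed

lemma sum_keys_add:
  fixes h :: "'a \<Rightarrow> 'b::ab_group_add \<Rightarrow> 'c::ab_group_add"
  assumes "\<And>t. h t 0 = 0" "\<And>t a b. h t (a + b) = h t a + h t b"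
  shows "(\<Sum>t\<in>Poly_Mapping.keys (F + G). h t (Poly_Mapping.lookup (F + G) t)) =
    (\<Sum>t\<in>Poly_Mapping.keys F. h t (Poly_Mapping.lookup F t)) + (\<Sum>t\<in>Poly_Mapping.keys G. h t (Poly_Mapping.lookup G t))"
proof -
  define I where "I = Poly_Mapping.keys F \<union> Poly_Mapping.keys G"
  have I: "(\<Sum>t\<in>Poly_Mapping.keys H. h t (Poly_Mapping.lookup H t)) = (\<Sum>t\<in>I. h t (Poly_Mapping.lookup H t))"
    if "Poly_Mapping.keys H \<subseteq> I" for H
    using that by (intro sum.mono_neutral_left) (auto simp: I_def in_keys_iff assms)
  have "Poly_Mapping.keys (F + G) \<subseteq> I" "Poly_Mapping.keys F \<subseteq> I" "Poly_Mapping.keys G \<subseteq> I"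
    using keys_add[of F G] by (auto simp: I_def)
  note eqs = this[THEN I]
  show ?thesis
    unfolding eqs by (simp add: lookup_add assms sum.distrib)
qed

lemma subst_single: "subst f (Poly_Mapping.single t c) = Poly_Mapping.single 0 c * (\<Prod>j\<in>UNIV. f j ^ Poly_Mapping.lookup t j)"
  by (cases "c = 0") (auto simp: subst_def)

lemma subst_add: "subst f (F + G) = subst f F + subst f G"
  unfolding subst_def by (rule sum_keys_add) (auto simp: single_add algebra_simps)

lemma subst_zero [simp]: "subst f 0 = 0"
  by (simp add: subst_def)

lemma subst_const: "subst f (Poly_Mapping.single 0 c) = Poly_Mapping.single 0 c"
  by (simp add: subst_single)

lemma subst_one [simp]: "subst f 1 = 1"
  using subst_const[of f 1] by simp

lemma subst_uminus: "subst f (- F) = - subst f F"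
  using subst_add[of f F "- F"] by (simp add: eq_neg_iff_add_eq_0 add.commute)

lemma subst_mult:
  fixes f :: "'m::finite \<Rightarrow> ('b, 'c::comm_ring_1) mpoly"
  shows "subst f (F * G) = subst f F * subst f G"
proof (induction F rule: mpoly_add_induct)
  case (single t c)
  show ?case
  proof (induction G rule: mpoly_add_induct)
    case (single s d)
    have *: "Poly_Mapping.single 0 (c * d) = Poly_Mapping.single 0 c * (Poly_Mapping.single 0 d :: ('b, 'c) mpoly)"
      by (simp add: mult_single)
    have "subst f (Poly_Mapping.single t c * Poly_Mapping.single s d) = Poly_Mapping.single 0 (c * d) *
        ((\<Prod>j\<in>UNIV. f j ^ Poly_Mapping.lookup t j) * (\<Prod>j\<in>UNIV. f j ^ Poly_Mapping.lookup s j))"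
      by (simp add: mult_single subst_single lookup_add power_add prod.distrib)
    then show ?case
      by (simp only: * subst_single mult_ac)
  qed (simp add: subst_add algebra_simps)
qed (simp add: subst_add algebra_simps)

lemma subst_var: "subst f (Poly_Mapping.single (Poly_Mapping.single j 1) 1) = f j"
proof -
  have "(\<Prod>i\<in>UNIV. f i ^ Poly_Mapping.lookup (Poly_Mapping.single j 1) i) = (\<Prod>i\<in>UNIV. if j = i then f i else 1)"
    by (intro prod.cong) (auto simp: lookup_single)
  also have "\<dots> = f j" by simp
  finally show ?thesis by (simp add: subst_single)
qed

lemma subst_sum: "subst f (\<Sum>i\<in>I. h i) = (\<Sum>i\<in>I. subst f (h i))"
  by (induction I rule: infinite_finite_induct) (auto simp: subst_add)

lemma pd_single: "pd v (Poly_Mapping.single t c) = Poly_Mapping.single (t - Poly_Mapping.single v 1) (of_nat (Poly_Mapping.lookup t v) * c)"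
  by (cases "c = 0") (auto simp: pd_def)

lemma pd_add: "pd v (F + G) = pd v F + pd v G"
  unfolding pd_def by (rule sum_keys_add) (auto simp: single_add algebra_simps)

lemma pd_zero [simp]: "pd v 0 = 0"
  by (simp add: pd_def)

lemma pd_uminus: "pd f (- F) = - pd f F"
  using pd_add[of f F "- F"] by (simp add: eq_neg_iff_add_eq_0 add.commute)

lemma pd_const [simp]: "pd v (Poly_Mapping.single 0 c) = 0"
  by (simp add: pd_single)

lemma pd_one [simp]: "pd v 1 = 0"
  using pd_const[of v 1] by simp

lemma pd_var: "pd v (Poly_Mapping.single (Poly_Mapping.single u 1) 1) = (if u = v then 1 else 0)"
  by (simp add: pd_single lookup_single when_def)

lemma pd_mult: "pd v (F * G) = pd v F * G + F * pd v G"
proof (induction F rule: mpoly_add_induct)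
  case (single t c)
  show ?case
  proof (induction G rule: mpoly_add_induct)
    case (single s d)
    have *: "Poly_Mapping.single (t - Poly_Mapping.single v 1 + s) (of_nat (Poly_Mapping.lookup t v) * c * d)
      = Poly_Mapping.single (t + s - Poly_Mapping.single v 1) (of_nat (Poly_Mapping.lookup t v) * c * d)" for t s c d
    proof (cases "Poly_Mapping.lookup t v = 0")
      case False
      then have "t - Poly_Mapping.single v 1 + s = t + s - Poly_Mapping.single v 1"
        by (intro poly_mapping_eqI) (auto simp: lookup_add lookup_minus lookup_single when_def)
      then show ?thesis by simp
    qed simp
    show ?case
      using *[of t s c d] *[of s t d c]
      by (simp add: mult_single pd_single lookup_add algebra_simps flip: single_add)
  qed (simp add: pd_add algebra_simps)
qed (simp add: pd_add algebra_simps)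

lemma mpoly_induct [case_names const var add mult]:
  fixes F :: "('v::finite, 'k::comm_ring_1) mpoly"
  assumes "\<And>c. Q (Poly_Mapping.single 0 c)"
    and "\<And>v. Q (Poly_Mapping.single (Poly_Mapping.single v 1) 1)"
    and "\<And>F G. Q F \<Longrightarrow> Q G \<Longrightarrow> Q (F + G)"
    and "\<And>F G. Q F \<Longrightarrow> Q G \<Longrightarrow> Q (F * G)"
  shows "Q F"
proof -
  let ?X = "\<lambda>v::'v. Poly_Mapping.single (Poly_Mapping.single v 1) (1::'k)"
  have pow: "?X v ^ n = Poly_Mapping.single (Poly_Mapping.single v n) 1" for v n
    by (induction n) (auto simp: mult_single simp flip: single_add)
  have mono: "(\<Prod>v\<in>I. ?X v ^ e v) = Poly_Mapping.single (\<Sum>v\<in>I. Poly_Mapping.single v (e v)) 1" for e I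
    by (induction I rule: infinite_finite_induct) (auto simp: pow mult_single simp del: One_nat_def)
  have exp: "(\<Sum>v\<in>UNIV. Poly_Mapping.single v (Poly_Mapping.lookup t v)) = t" for t :: "'v \<Rightarrow>\<^sub>0 nat"
    by (rule poly_mapping_eqI) (simp add: lookup_sum lookup_single when_def sum.delta)
  have Qpow: "Q (?X v ^ n)" for v n
    using assms(1)[of 1] by (induction n) (auto intro: assms simp del: One_nat_def)
  have Qprod: "Q (\<Prod>v\<in>I. ?X v ^ e v)" for e I
    using assms(1)[of 1] by (induction I rule: infinite_finite_induct) (auto intro: assms Qpow simp del: One_nat_def)
  show ?thesis
  proof (induction F rule: mpoly_add_induct)
    case (single t c)
    have "Poly_Mapping.single t c = Poly_Mapping.single 0 c * (\<Prod>v\<in>UNIV. ?X v ^ Poly_Mapping.lookup t v)"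
      by (simp only: mono exp mult_single add_0 mult_1_right)
    then show ?case by (simp only: assms Qprod)
  qed (rule assms)
qed

lemma chain_rule: "pd i (subst f F) = (\<Sum>j\<in>UNIV. subst f (pd j F) * pd i (f j))"
proof (induction F rule: mpoly_induct)
  case (var v)
  have "(\<Sum>j\<in>UNIV. subst f (pd j (Poly_Mapping.single (Poly_Mapping.single v 1) 1)) * pd i (f j))
      = (\<Sum>j\<in>UNIV. if v = j then pd i (f j) else 0)"
    unfolding pd_var by (intro sum.cong) auto
  also have "\<dots> = pd i (f v)" by simp
  finally show ?case by (simp only: subst_var)
next
  case (mult F G)
  have "pd i (subst f (F * G)) = pd i (subst f F) * subst f G + subst f F * pd i (subst f G)"
    by (simp only: subst_mult pd_mult)
  also have "\<dots> = (\<Sum>j\<in>UNIV. subst f (pd j F) * pd i (f j) * subst f G + subst f F * (subst f (pd j G) * pd i (f j)))"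
    unfolding mult.IH sum_distrib_left sum_distrib_right sum.distrib ..
  also have "\<dots> = (\<Sum>j\<in>UNIV. subst f (pd j (F * G)) * pd i (f j))"
    by (intro sum.cong) (simp_all add: subst_mult subst_add pd_mult algebra_simps)
  finally show ?case .
next
  case (add F G)
  then show ?case by (simp add: subst_add pd_add distrib_right sum.distrib)
qed (simp add: subst_const)

section \<open>Well-definedness of the maps on classes\<close>

lemma rel_ideal_smult: "F \<in> rel_ideal f \<Longrightarrow> G * F \<in> rel_ideal f"
  by (simp add: rel_ideal_def subst_mult)

lemma rel_ideal2_iff:
  "F \<in> rel_ideal2 f \<longleftrightarrow> (\<exists>s. s \<notin> rel_ideal f \<and> s * F \<in> ideal_prod poly_ring (rel_ideal f) (rel_ideal f))"
proof -
  have "ideal_prod poly_ring UNIV (rel_ideal f) = rel_ideal f" (is "?L = ?R")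
  proof
    show "?L \<subseteq> ?R"
    proof
      fix F assume "F \<in> ?L" then show "F \<in> ?R"
        by induction (auto simp: class_ring_def rel_ideal_def subst_mult subst_add)
    qed
    show "?R \<subseteq> ?L"
      using ideal_prod.prod[of 1 UNIV _ "rel_ideal f" poly_ring] by (auto simp: class_ring_def)
  qed
  then show ?thesis
    by (auto simp: symbolic_power_def numeral_2_eq_2 ideals_set_def) (auto simp: class_ring_def)
qed

lemma delta_rep_add: "delta_rep f (F + G) = (\<lambda>j. delta_rep f F j + delta_rep f G j)"
  by (simp add: delta_rep_def pd_add subst_add)

lemma delta_rep_mult: "delta_rep f (G * F) = (\<lambda>j. subst f G * delta_rep f F j + subst f F * delta_rep f G j)"
  by (simp add: delta_rep_def pd_mult subst_add subst_mult algebra_simps)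

lemma rel_ideal2D:
  fixes f :: "'m::finite \<Rightarrow> ('n::linorder, 'k::idom) mpoly"
  assumes "F \<in> rel_ideal2 f"
  shows "F \<in> rel_ideal f" "delta_rep f F = (\<lambda>_. 0)"
proof -
  obtain s where s: "s \<notin> rel_ideal f" "s * F \<in> ideal_prod poly_ring (rel_ideal f) (rel_ideal f)"
    using assms unfolding rel_ideal2_iff by blast
  from s(2) have *: "subst f (s * F) = 0 \<and> delta_rep f (s * F) = (\<lambda>_. 0)"
    by induction (auto simp: class_ring_def rel_ideal_def subst_mult subst_add delta_rep_add delta_rep_mult)
  then show "F \<in> rel_ideal f"
    using s(1) by (auto simp: rel_ideal_def subst_mult)
  with * s(1) show "delta_rep f F = (\<lambda>_. 0)"
    by (auto simp: rel_ideal_def delta_rep_mult fun_eq_iff)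
qed

lemma rel_ideal2_zero:
  fixes f :: "'m::finite \<Rightarrow> ('n, 'k::comm_ring_1) mpoly"
  shows "0 \<in> rel_ideal2 f"
proof -
  have "1 \<notin> rel_ideal f" by (simp add: rel_ideal_def)
  moreover have "0 \<otimes>\<^bsub>poly_ring\<^esub> 0 \<in> ideal_prod poly_ring (rel_ideal f) (rel_ideal f)"
    by (rule ideal_prod.prod) (auto simp: rel_ideal_def)
  ultimately show ?thesis unfolding rel_ideal2_iff by (auto simp: class_ring_def)
qed

lemma ideal_prod_rel_ideal_smult:
  "H \<in> ideal_prod poly_ring (rel_ideal f) (rel_ideal f)
    \<Longrightarrow> G * H \<in> ideal_prod poly_ring (rel_ideal f) (rel_ideal f)"
proof (induction rule: ideal_prod.induct)
  case (prod i j)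
  then have "(G * i) \<otimes>\<^bsub>poly_ring\<^esub> j \<in> ideal_prod poly_ring (rel_ideal f) (rel_ideal f)"
    by (intro ideal_prod.prod rel_ideal_smult)
  then show ?case by (simp add: class_ring_def mult.assoc)
next
  case (sum s1 s2)
  then show ?case using ideal_prod.sum[of "G * s1" poly_ring "rel_ideal f" "rel_ideal f" "G * s2"]
    by (simp add: class_ring_def algebra_simps)
qed

lemma rel_ideal2_smult:
  assumes "F \<in> rel_ideal2 f" shows "G * F \<in> rel_ideal2 f"
proof -
  obtain s where s: "s \<notin> rel_ideal f" "s * F \<in> ideal_prod poly_ring (rel_ideal f) (rel_ideal f)"
    using assms unfolding rel_ideal2_iff by blast
  have "s * (G * F) = G * (s * F)" by (rule mult.left_commute)
  with ideal_prod_rel_ideal_smult[OF s(2), of G] s(1) show ?thesis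
    unfolding rel_ideal2_iff by metis
qed

lemma rel_ideal2_add:
  fixes f :: "'m::finite \<Rightarrow> ('n::linorder, 'k::idom) mpoly"
  assumes "F \<in> rel_ideal2 f" "G \<in> rel_ideal2 f" shows "F + G \<in> rel_ideal2 f"
proof -
  let ?I = "ideal_prod poly_ring (rel_ideal f) (rel_ideal f)"
  obtain s t where s: "s \<notin> rel_ideal f" "s * F \<in> ?I" and t: "t \<notin> rel_ideal f" "t * G \<in> ?I"
    using assms unfolding rel_ideal2_iff by blast
  have "s * t \<notin> rel_ideal f" using s t by (auto simp: rel_ideal_def subst_mult)
  moreover have "s * t * (F + G) \<in> ?I"
    using ideal_prod.sum[OF ideal_prod_rel_ideal_smult[OF s(2), of t] ideal_prod_rel_ideal_smult[OF t(2), of s]]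
    by (simp add: class_ring_def algebra_simps)
  ultimately show ?thesis unfolding rel_ideal2_iff by blast
qed

lemma coset_poly_ring: "I +>\<^bsub>poly_ring\<^esub> F = (\<lambda>G. G + F) ` I"
  by (auto simp: a_r_coset_def r_coset_def class_ring_def)

lemma coset_eq_poly_ring:
  fixes f :: "'m::finite \<Rightarrow> ('n::linorder, 'k::idom) mpoly"
  assumes "F - G \<in> rel_ideal2 f"
  shows "rel_ideal2 f +>\<^bsub>poly_ring\<^esub> F = rel_ideal2 f +>\<^bsub>poly_ring\<^esub> G"
proof -
  have "H + F \<in> (\<lambda>H. H + G) ` rel_ideal2 f" if "F - G \<in> rel_ideal2 f" "H \<in> rel_ideal2 f" for F G H
    using rel_ideal2_add[OF that] by (intro image_eqI[of _ _ "F - G + H"]) auto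
  moreover have "G - F \<in> rel_ideal2 f"
    using rel_ideal2_smult[OF assms, of "-1"] by simp
  ultimately show ?thesis using assms by (force simp: coset_poly_ring)
qed

lemma carrier_conormal: "carrier (conormal f) = (\<lambda>F. rel_ideal2 f +>\<^bsub>poly_ring\<^esub> F) ` rel_ideal f"
  by (auto simp: conormal_def A_RCOSETS_def RCOSETS_def a_r_coset_def r_coset_def)

lemma conormal_smult:
  fixes f :: "'m::finite \<Rightarrow> ('n::linorder, 'k::idom) mpoly"
  assumes F: "F \<in> rel_ideal f"
  shows "subst f G \<odot>\<^bsub>conormal f\<^esub> (rel_ideal2 f +>\<^bsub>poly_ring\<^esub> F) = rel_ideal2 f +>\<^bsub>poly_ring\<^esub> (G * F)"
proof -
  have "rel_ideal2 f +>\<^bsub>poly_ring\<^esub> (G' * (H + F)) = rel_ideal2 f +>\<^bsub>poly_ring\<^esub> (G * F)"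
    if "subst f G' = subst f G" "H \<in> rel_ideal2 f" for G' H
  proof (rule coset_eq_poly_ring)
    have "G' - G \<in> rel_ideal f"
      using that(1) subst_add[of f "G' - G" G] by (simp add: rel_ideal_def)
    then have "(G' - G) \<otimes>\<^bsub>poly_ring\<^esub> F \<in> ideal_prod poly_ring (rel_ideal f) (rel_ideal f)"
      using F by (rule ideal_prod.prod)
    then have "(G' - G) * F \<in> rel_ideal2 f"
      unfolding rel_ideal2_iff
      by (intro exI[of _ 1]) (auto simp: class_ring_def rel_ideal_def)
    from rel_ideal2_add[OF this rel_ideal2_smult[OF that(2), of G']]
    show "G' * (H + F) - G * F \<in> rel_ideal2 f"
      by (simp add: algebra_simps)
  qed
  moreover have "0 \<in> rel_ideal2 f" by (rule rel_ideal2_zero)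
  ultimately show ?thesis
    by (auto simp: conormal_def coset_poly_ring[of _ F])
qed

lemma delta_coset:
  fixes f :: "'m::finite \<Rightarrow> ('n::linorder, 'k::idom) mpoly"
  shows "delta f (rel_ideal2 f +>\<^bsub>poly_ring\<^esub> F) = delta_rep f F"
proof -
  have "delta_rep f ` (rel_ideal2 f +>\<^bsub>poly_ring\<^esub> F) = {delta_rep f F}"
    using rel_ideal2_zero[of f]
    by (auto simp: coset_poly_ring image_image delta_rep_add rel_ideal2D image_iff)
  then show ?thesis by (simp add: delta_def)
qed

lemma delta_image:
  fixes f :: "'m::finite \<Rightarrow> ('n::linorder, 'k::idom) mpoly"
  shows "delta f ` carrier (conormal f) = delta_rep f ` rel_ideal f"
  by (simp add: carrier_conormal image_image delta_coset)

lemma coset_free_module: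
  "N +>\<^bsub>free_module (subalg f)\<^esub> v = (\<lambda>w j. w j + v j) ` N"
  by (auto simp: a_r_coset_def r_coset_def free_module_def subalg_def class_ring_def)

lemma leibniz_coset:
  fixes f :: "'m::finite \<Rightarrow> ('n::linorder, 'k::idom) mpoly"
  shows "leibniz f ((delta f ` carrier (conormal f)) +>\<^bsub>free_module (subalg f)\<^esub> v) = jac_map f v"
proof -
  have "jac_map f (\<lambda>j. delta_rep f F j + v j) = jac_map f v" if "F \<in> rel_ideal f" for F
  proof
    fix i
    have "jac_map f (\<lambda>j. delta_rep f F j + v j) i = pd i (subst f F) + jac_map f v i"
      by (simp add: jac_map_def delta_rep_def chain_rule grad_def distrib_right sum.distrib)
    then show "jac_map f (\<lambda>j. delta_rep f F j + v j) i = jac_map f v i"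
      using that by (simp add: rel_ideal_def)
  qed
  moreover have "0 \<in> rel_ideal f" by (simp add: rel_ideal_def)
  ultimately have "jac_map f ` ((delta f ` carrier (conormal f)) +>\<^bsub>free_module (subalg f)\<^esub> v) = {jac_map f v}"
    by (auto simp: coset_free_module image_image delta_image image_iff)
  then show ?thesis by (simp add: leibniz_def)
qed

section \<open>Kaehler differentials\<close>

definition univ_der :: "('m::finite \<Rightarrow> ('n, 'k::comm_ring_1) mpoly) \<Rightarrow> ('n, 'k) mpoly \<Rightarrow> ('m \<Rightarrow> ('n, 'k) mpoly) set" where
  "univ_der f a = the_elem ((\<lambda>F. (delta f ` carrier (conormal f)) +>\<^bsub>free_module (subalg f)\<^esub> delta_rep f F) ` {F. subst f F = a})"

text \<open>An additive map satisfying the Leibniz rule is \<open>k\<close>-linear iff it vanishes on constants.\<close>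

definition derivations :: "('m::finite \<Rightarrow> ('n, 'k::comm_ring_1) mpoly) \<Rightarrow> (('n, 'k) mpoly, 'b) module \<Rightarrow> (('n, 'k) mpoly \<Rightarrow> 'b) set" where
  "derivations f M = {D \<in> carrier (subalg f) \<rightarrow> carrier M.
    (\<forall>a\<in>carrier (subalg f). \<forall>b\<in>carrier (subalg f). D (a + b) = D a \<oplus>\<^bsub>M\<^esub> D b) \<and>
    (\<forall>a\<in>carrier (subalg f). \<forall>b\<in>carrier (subalg f). D (a * b) = (a \<odot>\<^bsub>M\<^esub> D b) \<oplus>\<^bsub>M\<^esub> (b \<odot>\<^bsub>M\<^esub> D a)) \<and>
    (\<forall>c. D (Poly_Mapping.single 0 c) = \<zero>\<^bsub>M\<^esub>)}"

lemma subst_in_subalg: "subst f F \<in> carrier (subalg f)"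
  by (simp add: subalg_def class_ring_def)

lemma cring_subalg: "cring (subalg f)"
proof (rule cringI)
  show "abelian_group (subalg f)"
  proof (rule abelian_groupI)
    fix x assume "x \<in> carrier (subalg f)"
    then obtain F where "x = subst f F" by (auto simp: subalg_def class_ring_def)
    then show "\<exists>y\<in>carrier (subalg f). y \<oplus>\<^bsub>subalg f\<^esub> x = \<zero>\<^bsub>subalg f\<^esub>"
      by (intro bexI[of _ "subst f (- F)"] subst_in_subalg) (simp add: subst_uminus subalg_def class_ring_def)
  qed (auto simp: subalg_def class_ring_def algebra_simps image_iff simp flip: subst_add intro: exI[of _ 0])
  show "Group.comm_monoid (subalg f)"
    by (rule Group.comm_monoidI)
      (auto simp: subalg_def class_ring_def algebra_simps image_iff simp flip: subst_mult intro: exI[of _ 1])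
qed (auto simp: subalg_def class_ring_def algebra_simps)

lemma conormal_add:
  fixes f :: "'m::finite \<Rightarrow> ('n::linorder, 'k::idom) mpoly"
  shows "(rel_ideal2 f +>\<^bsub>poly_ring\<^esub> F) \<oplus>\<^bsub>conormal f\<^esub> (rel_ideal2 f +>\<^bsub>poly_ring\<^esub> G) = rel_ideal2 f +>\<^bsub>poly_ring\<^esub> (F + G)"
proof
  show "(rel_ideal2 f +>\<^bsub>poly_ring\<^esub> F) \<oplus>\<^bsub>conormal f\<^esub> (rel_ideal2 f +>\<^bsub>poly_ring\<^esub> G) \<subseteq> rel_ideal2 f +>\<^bsub>poly_ring\<^esub> (F + G)"
  proof
    fix x assume "x \<in> (rel_ideal2 f +>\<^bsub>poly_ring\<^esub> F) \<oplus>\<^bsub>conormal f\<^esub> (rel_ideal2 f +>\<^bsub>poly_ring\<^esub> G)"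
    then obtain h h' where h: "h \<in> rel_ideal2 f" "h' \<in> rel_ideal2 f" and x: "x = (h + F) + (h' + G)"
      unfolding conormal_def coset_poly_ring by (auto simp: set_add_def set_mult_def class_ring_def)
    have "x = (h + h') + (F + G)" unfolding x by (simp add: algebra_simps)
    with rel_ideal2_add[OF h] show "x \<in> rel_ideal2 f +>\<^bsub>poly_ring\<^esub> (F + G)"
      unfolding coset_poly_ring by blast
  qed
  show "rel_ideal2 f +>\<^bsub>poly_ring\<^esub> (F + G) \<subseteq> (rel_ideal2 f +>\<^bsub>poly_ring\<^esub> F) \<oplus>\<^bsub>conormal f\<^esub> (rel_ideal2 f +>\<^bsub>poly_ring\<^esub> G)"
  proof
    fix x assume "x \<in> rel_ideal2 f +>\<^bsub>poly_ring\<^esub> (F + G)"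
    then obtain h where h: "h \<in> rel_ideal2 f" and x: "x = (h + F) + (0 + G)"
      unfolding coset_poly_ring by (auto simp: algebra_simps)
    have "h + F \<in> rel_ideal2 f +>\<^bsub>poly_ring\<^esub> F" "0 + G \<in> rel_ideal2 f +>\<^bsub>poly_ring\<^esub> G"
      unfolding coset_poly_ring using h rel_ideal2_zero[of f] by blast+
    then show "x \<in> (rel_ideal2 f +>\<^bsub>poly_ring\<^esub> F) \<oplus>\<^bsub>conormal f\<^esub> (rel_ideal2 f +>\<^bsub>poly_ring\<^esub> G)"
      unfolding x by (simp only: conormal_def set_add_def set_mult_def ring.simps partial_object.simps monoid.simps class_ring_def) blast
  qed
qed

lemma module_conormal:
  fixes f :: "'m::finite \<Rightarrow> ('n::linorder, 'k::idom) mpoly"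
  shows "module (subalg f) (conormal f)"
proof -
  let ?c = "\<lambda>F. rel_ideal2 f +>\<^bsub>poly_ring\<^esub> F"
  note add = conormal_add[of f] and sm = conormal_smult[of _ f]
  have closed: "?c F \<in> carrier (conormal f)" if "F \<in> rel_ideal f" for F
    unfolding carrier_conormal using that by (rule imageI)
  have rep: "\<exists>F\<in>rel_ideal f. X = ?c F" if "X \<in> carrier (conormal f)" for X
    using that unfolding carrier_conormal by blast
  have zero: "\<zero>\<^bsub>conormal f\<^esub> = ?c 0"
    by (simp add: coset_poly_ring) (simp add: conormal_def)
  have P: "0 \<in> rel_ideal f" "F \<in> rel_ideal f \<Longrightarrow> - F \<in> rel_ideal f"
    "F \<in> rel_ideal f \<Longrightarrow> G \<in> rel_ideal f \<Longrightarrow> F + G \<in> rel_ideal f" for F G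
    by (simp_all add: rel_ideal_def subst_uminus subst_add)
  have rep_A: "\<exists>G. a = subst f G" if "a \<in> carrier (subalg f)" for a
    using that by (auto simp: subalg_def class_ring_def)
  have ops: "subst f F \<oplus>\<^bsub>subalg f\<^esub> subst f G = subst f (F + G)" "subst f F \<otimes>\<^bsub>subalg f\<^esub> subst f G = subst f (F * G)"
    "\<one>\<^bsub>subalg f\<^esub> = subst f 1" for F G
    by (simp_all add: subalg_def class_ring_def subst_add subst_mult)
  have group: "abelian_group (conormal f)"
  proof (rule abelian_groupI)
    fix X Y assume "X \<in> carrier (conormal f)" "Y \<in> carrier (conormal f)"
    then obtain F G where "F \<in> rel_ideal f" "X = ?c F" "G \<in> rel_ideal f" "Y = ?c G" using rep by metis
    then show "X \<oplus>\<^bsub>conormal f\<^esub> Y \<in> carrier (conormal f)" by (simp only: add closed P)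
  next
    fix X Y Z assume "X \<in> carrier (conormal f)" "Y \<in> carrier (conormal f)" "Z \<in> carrier (conormal f)"
    then obtain F G H where "X = ?c F" "Y = ?c G" "Z = ?c H" using rep by metis
    then show "X \<oplus>\<^bsub>conormal f\<^esub> Y \<oplus>\<^bsub>conormal f\<^esub> Z = X \<oplus>\<^bsub>conormal f\<^esub> (Y \<oplus>\<^bsub>conormal f\<^esub> Z)"
      by (simp only: add add.assoc)
  next
    fix X Y assume "X \<in> carrier (conormal f)" "Y \<in> carrier (conormal f)"
    then obtain F G where XY: "X = ?c F" "Y = ?c G" using rep by metis
    show "X \<oplus>\<^bsub>conormal f\<^esub> Y = Y \<oplus>\<^bsub>conormal f\<^esub> X"
      unfolding XY add by (simp only: add.commute)
  next
    fix X assume "X \<in> carrier (conormal f)"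
    then obtain F where F: "F \<in> rel_ideal f" "X = ?c F" using rep by metis
    then show "\<zero>\<^bsub>conormal f\<^esub> \<oplus>\<^bsub>conormal f\<^esub> X = X" by (simp only: zero add add_0)
    have "?c (- F) \<oplus>\<^bsub>conormal f\<^esub> X = \<zero>\<^bsub>conormal f\<^esub>"
      by (simp only: F zero add left_minus)
    then show "\<exists>Y\<in>carrier (conormal f). Y \<oplus>\<^bsub>conormal f\<^esub> X = \<zero>\<^bsub>conormal f\<^esub>"
      using closed[OF P(2)[OF F(1)]] by blast
  qed (simp only: zero closed P)
  show ?thesis
  proof (rule moduleI[OF cring_subalg group])
    fix a X assume "a \<in> carrier (subalg f)" "X \<in> carrier (conormal f)"
    then obtain G F where "a = subst f G" "F \<in> rel_ideal f" "X = ?c F" using rep rep_A by metis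
    then show "a \<odot>\<^bsub>conormal f\<^esub> X \<in> carrier (conormal f)" by (simp only: sm closed rel_ideal_smult)
  next
    fix a b X assume "a \<in> carrier (subalg f)" "b \<in> carrier (subalg f)" "X \<in> carrier (conormal f)"
    then obtain G H F where *: "a = subst f G" "b = subst f H" "F \<in> rel_ideal f" "X = ?c F" using rep rep_A by metis
    show "(a \<oplus>\<^bsub>subalg f\<^esub> b) \<odot>\<^bsub>conormal f\<^esub> X = a \<odot>\<^bsub>conormal f\<^esub> X \<oplus>\<^bsub>conormal f\<^esub> b \<odot>\<^bsub>conormal f\<^esub> X"
      unfolding *(1,2,4) ops sm[OF *(3)] add by (simp only: distrib_right)
    show "(a \<otimes>\<^bsub>subalg f\<^esub> b) \<odot>\<^bsub>conormal f\<^esub> X = a \<odot>\<^bsub>conormal f\<^esub> (b \<odot>\<^bsub>conormal f\<^esub> X)"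
      unfolding *(1,2,4) ops sm[OF *(3)] sm[OF rel_ideal_smult[OF *(3)]] by (simp only: mult.assoc)
  next
    fix a X Y assume "a \<in> carrier (subalg f)" "X \<in> carrier (conormal f)" "Y \<in> carrier (conormal f)"
    then obtain G F H where *: "a = subst f G" "F \<in> rel_ideal f" "X = ?c F" "H \<in> rel_ideal f" "Y = ?c H" using rep rep_A by metis
    show "a \<odot>\<^bsub>conormal f\<^esub> (X \<oplus>\<^bsub>conormal f\<^esub> Y) = a \<odot>\<^bsub>conormal f\<^esub> X \<oplus>\<^bsub>conormal f\<^esub> a \<odot>\<^bsub>conormal f\<^esub> Y"
      unfolding *(1,3,5) add sm[OF *(2)] sm[OF *(4)] sm[OF P(3)[OF *(2,4)]] by (simp only: distrib_left)
  next
    fix X assume "X \<in> carrier (conormal f)"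
    then obtain F where F: "F \<in> rel_ideal f" "X = ?c F" using rep by metis
    show "\<one>\<^bsub>subalg f\<^esub> \<odot>\<^bsub>conormal f\<^esub> X = X"
      unfolding F(2) ops sm[OF F(1)] by simp
  qed
qed

lemma module_free_module:
  fixes R :: "('a, 'b) ring_scheme"
  assumes "cring R" shows "module R (free_module R :: ('a, 'i \<Rightarrow> 'a) module)"
proof -
  interpret cring R by fact
  show ?thesis
  proof (rule moduleI)
    show "abelian_group (free_module R :: ('a, 'i \<Rightarrow> 'a) module)"
    proof (rule abelian_groupI)
      fix x assume "x \<in> carrier (free_module R :: ('a, 'i \<Rightarrow> 'a) module)"
      then show "\<exists>y\<in>carrier (free_module R). y \<oplus>\<^bsub>free_module R\<^esub> x = \<zero>\<^bsub>free_module R\<^esub>"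
        by (intro bexI[of _ "\<lambda>i. \<ominus>\<^bsub>R\<^esub> x i"]) (auto simp: free_module_def Pi_iff l_neg)
    qed (auto simp: free_module_def Pi_iff a_ac)
  qed (auto simp: free_module_def Pi_iff is_cring l_distr r_distr m_assoc)
qed

lemma smult_quotient_module:
  assumes "module R M" "submodule N R M" "a \<in> carrier R" "x \<in> carrier M"
  shows "a \<odot>\<^bsub>quotient_module M N\<^esub> (N +>\<^bsub>M\<^esub> x) = N +>\<^bsub>M\<^esub> (a \<odot>\<^bsub>M\<^esub> x)"
proof -
  interpret module R M by fact
  interpret N: submodule N R M by fact
  interpret N: abelian_subgroup N M
    by (rule abelian_subgroupI3) (auto intro: additive_subgroup.intro N.subgroup_axioms abelian_group_axioms)
  have x: "x \<in> N +>\<^bsub>M\<^esub> x" using assms by (intro N.a_rcos_self)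
  have eq: "N +>\<^bsub>M\<^esub> (a \<odot>\<^bsub>M\<^esub> y) = N +>\<^bsub>M\<^esub> (a \<odot>\<^bsub>M\<^esub> x)" if "y \<in> N +>\<^bsub>M\<^esub> x" for y
  proof -
    have "\<exists>h\<in>N. y = h \<oplus>\<^bsub>M\<^esub> x"
      using that by (simp add: a_r_coset_def')
    then obtain h where h: "h \<in> N" "y = h \<oplus>\<^bsub>M\<^esub> x" ..
    then have hc: "h \<in> carrier M" by (rule_tac N.a_Hcarr)
    have "a \<odot>\<^bsub>M\<^esub> y = a \<odot>\<^bsub>M\<^esub> h \<oplus>\<^bsub>M\<^esub> a \<odot>\<^bsub>M\<^esub> x"
      using h hc assms by (simp add: smult_r_distr)
    moreover have "a \<odot>\<^bsub>M\<^esub> h \<in> N" using h assms by (intro N.smult_closed)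
    ultimately have "a \<odot>\<^bsub>M\<^esub> y \<in> N +>\<^bsub>M\<^esub> (a \<odot>\<^bsub>M\<^esub> x)"
      by (auto simp add: a_r_coset_def')
    then show ?thesis using assms by (intro M.a_repr_independence[symmetric] N.a_subgroup) auto
  qed
  have "a \<odot>\<^bsub>quotient_module M N\<^esub> (N +>\<^bsub>M\<^esub> x) = (\<Union>y\<in>N +>\<^bsub>M\<^esub> x. N +>\<^bsub>M\<^esub> (a \<odot>\<^bsub>M\<^esub> y))"
    by (simp add: quotient_module_def)
  also have "\<dots> = (\<Union>y\<in>N +>\<^bsub>M\<^esub> x. N +>\<^bsub>M\<^esub> (a \<odot>\<^bsub>M\<^esub> x))"
    by (rule SUP_cong[OF refl eq])
  finally show ?thesis using x by auto
qed

lemma module_quotient_module: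
  assumes "module R M" "submodule N R M"
  shows "module R (quotient_module M N)"
proof -
  interpret module R M by fact
  interpret N: submodule N R M by fact
  interpret N: abelian_subgroup N M
    by (rule abelian_subgroupI3) (auto intro: additive_subgroup.intro N.subgroup_axioms abelian_group_axioms)
  note sm = smult_quotient_module[OF assms]
  have add: "(N +>\<^bsub>M\<^esub> x) \<oplus>\<^bsub>quotient_module M N\<^esub> (N +>\<^bsub>M\<^esub> y) = N +>\<^bsub>M\<^esub> (x \<oplus>\<^bsub>M\<^esub> y)"
    if "x \<in> carrier M" "y \<in> carrier M" for x y
    using that by (simp add: quotient_module_def N.a_rcos_sum)
  have closed: "N +>\<^bsub>M\<^esub> x \<in> carrier (quotient_module M N)" if "x \<in> carrier M" for x
    using that by (auto simp: quotient_module_def A_RCOSETS_def RCOSETS_def a_r_coset_def)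
  have rep: "\<exists>x\<in>carrier M. X = N +>\<^bsub>M\<^esub> x" if "X \<in> carrier (quotient_module M N)" for X
    using that by (auto simp: quotient_module_def A_RCOSETS_def RCOSETS_def a_r_coset_def)
  have zero: "\<zero>\<^bsub>quotient_module M N\<^esub> = N +>\<^bsub>M\<^esub> \<zero>\<^bsub>M\<^esub>"
    unfolding a_r_coset_def' using N.a_Hcarr by (auto simp: quotient_module_def)
  have group: "abelian_group (quotient_module M N)"
  proof (rule abelian_groupI)
    fix X assume "X \<in> carrier (quotient_module M N)"
    then obtain x where "x \<in> carrier M" "X = N +>\<^bsub>M\<^esub> x" using rep by blast
    then show "\<exists>Y\<in>carrier (quotient_module M N). Y \<oplus>\<^bsub>quotient_module M N\<^esub> X = \<zero>\<^bsub>quotient_module M N\<^esub>"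
      by (intro bexI[of _ "N +>\<^bsub>M\<^esub> (\<ominus>\<^bsub>M\<^esub> x)"]) (auto simp: add M.l_neg zero closed)
  next
    fix X Y assume "X \<in> carrier (quotient_module M N)" "Y \<in> carrier (quotient_module M N)"
    then obtain x y where "x \<in> carrier M" "X = N +>\<^bsub>M\<^esub> x" "y \<in> carrier M" "Y = N +>\<^bsub>M\<^esub> y"
      using rep by metis
    then show "X \<oplus>\<^bsub>quotient_module M N\<^esub> Y = Y \<oplus>\<^bsub>quotient_module M N\<^esub> X"
      by (simp add: add M.a_comm)
  qed (auto dest!: rep simp: add zero closed M.a_assoc)
  show ?thesis
  proof (rule moduleI[OF is_cring group])
    fix a X assume "a \<in> carrier R" "X \<in> carrier (quotient_module M N)"
    then obtain x where "a \<in> carrier R" "x \<in> carrier M" "X = N +>\<^bsub>M\<^esub> x"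
      using rep by metis
    then show "a \<odot>\<^bsub>quotient_module M N\<^esub> X \<in> carrier (quotient_module M N)"
      by (simp add: sm closed)
  next
    fix a b X assume "a \<in> carrier R" "b \<in> carrier R" "X \<in> carrier (quotient_module M N)"
    then obtain x where "a \<in> carrier R" "b \<in> carrier R" "x \<in> carrier M" "X = N +>\<^bsub>M\<^esub> x"
      using rep by metis
    then show "(a \<oplus>\<^bsub>R\<^esub> b) \<odot>\<^bsub>quotient_module M N\<^esub> X = a \<odot>\<^bsub>quotient_module M N\<^esub> X \<oplus>\<^bsub>quotient_module M N\<^esub> b \<odot>\<^bsub>quotient_module M N\<^esub> X"
      by (simp add: sm add smult_l_distr)
  next
    fix a X Y assume "a \<in> carrier R" "X \<in> carrier (quotient_module M N)" "Y \<in> carrier (quotient_module M N)"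
    then obtain x y where "a \<in> carrier R" "x \<in> carrier M" "X = N +>\<^bsub>M\<^esub> x" "y \<in> carrier M" "Y = N +>\<^bsub>M\<^esub> y"
      using rep by metis
    then show "a \<odot>\<^bsub>quotient_module M N\<^esub> (X \<oplus>\<^bsub>quotient_module M N\<^esub> Y) = a \<odot>\<^bsub>quotient_module M N\<^esub> X \<oplus>\<^bsub>quotient_module M N\<^esub> a \<odot>\<^bsub>quotient_module M N\<^esub> Y"
      by (simp add: sm add smult_r_distr)
  next
    fix a b X assume "a \<in> carrier R" "b \<in> carrier R" "X \<in> carrier (quotient_module M N)"
    then obtain x where "a \<in> carrier R" "b \<in> carrier R" "x \<in> carrier M" "X = N +>\<^bsub>M\<^esub> x"
      using rep by metis
    then show "(a \<otimes>\<^bsub>R\<^esub> b) \<odot>\<^bsub>quotient_module M N\<^esub> X = a \<odot>\<^bsub>quotient_module M N\<^esub> (b \<odot>\<^bsub>quotient_module M N\<^esub> X)"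
      by (simp add: sm smult_assoc1)
  next
    fix X assume "X \<in> carrier (quotient_module M N)"
    then obtain x where "x \<in> carrier M" "X = N +>\<^bsub>M\<^esub> x"
      using rep by metis
    then show "\<one>\<^bsub>R\<^esub> \<odot>\<^bsub>quotient_module M N\<^esub> X = X"
      by (simp add: sm)
  qed
qed

lemma submodule_delta_image:
  fixes f :: "'m::finite \<Rightarrow> ('n::linorder, 'k::idom) mpoly"
  shows "submodule (delta f ` carrier (conormal f)) (subalg f) (free_module (subalg f))"
proof -
  interpret module "subalg f" "free_module (subalg f) :: (_, 'm \<Rightarrow> _) module"
    by (intro module_free_module cring_subalg)
  have neg: "\<ominus>\<^bsub>free_module (subalg f)\<^esub> delta_rep f F = delta_rep f (- F)" for F
  proof (rule M.minus_equality)
    show "delta_rep f (- F) \<oplus>\<^bsub>free_module (subalg f)\<^esub> delta_rep f F = \<zero>\<^bsub>free_module (subalg f)\<^esub>"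
      by (simp add: delta_rep_def free_module_def subalg_def class_ring_def pd_uminus subst_uminus)
  qed (simp_all add: delta_rep_def free_module_def subalg_def class_ring_def)
  show ?thesis unfolding delta_image
  proof (rule submoduleI)
    show "\<zero>\<^bsub>free_module (subalg f)\<^esub> \<in> delta_rep f ` rel_ideal f"
      by (rule image_eqI[of _ _ 0]) (auto simp: delta_rep_def free_module_def subalg_def class_ring_def rel_ideal_def)
  next
    fix a b assume "a \<in> delta_rep f ` rel_ideal f" "b \<in> delta_rep f ` rel_ideal f"
    then obtain F G where "F \<in> rel_ideal f" "G \<in> rel_ideal f" "a = delta_rep f F" "b = delta_rep f G" by blast
    then show "a \<oplus>\<^bsub>free_module (subalg f)\<^esub> b \<in> delta_rep f ` rel_ideal f"
      by (intro image_eqI[of _ _ "F + G"]) (auto simp: delta_rep_add free_module_def subalg_def class_ring_def rel_ideal_def subst_add)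
  next
    fix a b assume "a \<in> carrier (subalg f)" "b \<in> delta_rep f ` rel_ideal f"
    then obtain F G where "F \<in> rel_ideal f" "a = subst f G" "b = delta_rep f F"
      by (auto simp: subalg_def class_ring_def)
    then show "a \<odot>\<^bsub>free_module (subalg f)\<^esub> b \<in> delta_rep f ` rel_ideal f"
      by (intro image_eqI[of _ _ "G * F"]) (auto simp: delta_rep_mult free_module_def subalg_def class_ring_def rel_ideal_def subst_mult)
  next
    fix a assume "a \<in> delta_rep f ` rel_ideal f"
    then show "\<ominus>\<^bsub>free_module (subalg f)\<^esub> a \<in> delta_rep f ` rel_ideal f"
      by (auto simp: neg rel_ideal_def subst_uminus)
  next
    show "delta_rep f ` rel_ideal f \<subseteq> carrier (free_module (subalg f))"
      by (auto simp: delta_rep_def free_module_def subalg_def class_ring_def)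
  qed
qed

lemma module_kaehler:
  fixes f :: "'m::finite \<Rightarrow> ('n::linorder, 'k::idom) mpoly"
  shows "module (subalg f) (kaehler f)"
  unfolding kaehler_def
  by (intro module_quotient_module module_free_module cring_subalg submodule_delta_image)

context
  fixes f :: "'m::finite \<Rightarrow> ('n::linorder, 'k::idom) mpoly"
begin

private abbreviation (input) "A \<equiv> subalg f"
private abbreviation (input) "cls v \<equiv> (delta f ` carrier (conormal f)) +>\<^bsub>free_module (subalg f)\<^esub> v"
private abbreviation (input) "rows \<equiv> (UNIV \<rightarrow> carrier (subalg f)) :: ('m \<Rightarrow> ('n, 'k) mpoly) set"

lemma delta_rep_carrier: "delta_rep f F \<in> rows"
  by (simp add: delta_rep_def subst_in_subalg)

lemma kaehler_carrier: "carrier (kaehler f) = (\<lambda>v. cls v) ` rows"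
  by (auto simp: kaehler_def quotient_module_def A_RCOSETS_def RCOSETS_def a_r_coset_def free_module_def)

lemma kaehler_add:
  assumes "v \<in> rows" "w \<in> rows"
  shows "cls v \<oplus>\<^bsub>kaehler f\<^esub> cls w = cls (\<lambda>j. v j + w j)"
proof -
  interpret L: module A "free_module A :: (_, 'm \<Rightarrow> _) module"
    by (intro module_free_module cring_subalg)
  interpret N: submodule "delta f ` carrier (conormal f)" A "free_module A :: (_, 'm \<Rightarrow> _) module"
    by (rule submodule_delta_image)
  interpret N: abelian_subgroup "delta f ` carrier (conormal f)" "free_module A :: (_, 'm \<Rightarrow> _) module"
    by (rule abelian_subgroupI3) (auto intro: additive_subgroup.intro N.subgroup_axioms L.M.abelian_group_axioms)
  have "v \<in> carrier (free_module A)" "w \<in> carrier (free_module A)"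
    using assms by (simp_all add: free_module_def)
  from N.a_rcos_sum[OF this] show ?thesis
    by (simp add: kaehler_def quotient_module_def) (simp add: free_module_def subalg_def class_ring_def)
qed

lemma kaehler_smult:
  assumes "a \<in> carrier A" "v \<in> rows"
  shows "a \<odot>\<^bsub>kaehler f\<^esub> cls v = cls (\<lambda>j. a * v j)"
proof -
  have "v \<in> carrier (free_module A)" using assms by (simp add: free_module_def)
  from smult_quotient_module[OF module_free_module[OF cring_subalg] submodule_delta_image assms(1) this]
  show ?thesis by (simp add: kaehler_def) (simp add: free_module_def subalg_def class_ring_def)
qed

lemma kaehler_zero: "\<zero>\<^bsub>kaehler f\<^esub> = cls (\<lambda>_. 0)"
  by (simp add: coset_free_module kaehler_def quotient_module_def)

lemma cls_eq:
  assumes "F \<in> rel_ideal f" "\<And>j. v j = delta_rep f F j + w j"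
  shows "cls v = cls w"
proof -
  have sub: "cls v \<subseteq> cls w" if F: "F \<in> rel_ideal f" and v: "\<And>j. v j = delta_rep f F j + w j" for F v w
  proof
    fix x assume "x \<in> cls v"
    then obtain G where G: "G \<in> rel_ideal f" "x = (\<lambda>j. delta_rep f G j + v j)"
      unfolding coset_free_module delta_image by blast
    have "x = (\<lambda>j. delta_rep f (G + F) j + w j)"
      unfolding G(2) v delta_rep_add by (simp add: add.assoc)
    moreover have "G + F \<in> rel_ideal f"
      using F G(1) by (simp add: rel_ideal_def subst_add)
    ultimately show "x \<in> cls w"
      unfolding coset_free_module delta_image by blast
  qed
  have "- F \<in> rel_ideal f" using assms(1) by (simp add: rel_ideal_def subst_uminus)
  moreover have "w j = delta_rep f (- F) j + v j" for j
    by (simp add: assms(2) delta_rep_def pd_uminus subst_uminus)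
  ultimately show ?thesis
    using sub[OF assms] sub[of "- F" w v] by blast
qed

lemma univ_der_subst: "univ_der f (subst f F) = cls (delta_rep f F)"
proof -
  have eq: "cls (delta_rep f G) = cls (delta_rep f F)" if "subst f G = subst f F" for G
  proof (rule cls_eq)
    show "G - F \<in> rel_ideal f"
      using that subst_add[of f "G - F" F] by (simp add: rel_ideal_def)
    show "delta_rep f G j = delta_rep f (G - F) j + delta_rep f F j" for j
      using fun_cong[OF delta_rep_add[of f "G - F" F]] by simp
  qed
  have "(\<lambda>G. cls (delta_rep f G)) ` {G. subst f G = subst f F} = (\<lambda>G. cls (delta_rep f F)) ` {G. subst f G = subst f F}"
    by (rule image_cong[OF refl eq]) simp
  also have "\<dots> = {cls (delta_rep f F)}" by blast
  finally have "(\<lambda>G. cls (delta_rep f G)) ` {G. subst f G = subst f F} = {cls (delta_rep f F)}" .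
  then show ?thesis by (simp only: univ_der_def the_elem_eq)
qed

lemma delta_rep_var:
  "delta_rep f (Poly_Mapping.single (Poly_Mapping.single i 1) 1) = (\<lambda>j. if i = j then 1 else 0)"
  unfolding delta_rep_def pd_var by (auto simp: fun_eq_iff)

lemma in_subalg_iff: "a \<in> carrier A \<longleftrightarrow> (\<exists>F. a = subst f F)"
  by (auto simp: subalg_def class_ring_def)

lemma univ_der_derivation: "univ_der f \<in> derivations f (kaehler f)"
proof -
  have add: "univ_der f (subst f F + subst f G) = univ_der f (subst f F) \<oplus>\<^bsub>kaehler f\<^esub> univ_der f (subst f G)" for F G
    by (simp only: univ_der_subst delta_rep_add kaehler_add delta_rep_carrier flip: subst_add)
  have mult: "univ_der f (subst f F * subst f G) = (subst f F \<odot>\<^bsub>kaehler f\<^esub> univ_der f (subst f G))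
      \<oplus>\<^bsub>kaehler f\<^esub> (subst f G \<odot>\<^bsub>kaehler f\<^esub> univ_der f (subst f F))" for F G
  proof -
    have *: "(\<lambda>j. subst f F * delta_rep f G j) \<in> rows" for F G
      by (simp add: delta_rep_def subst_in_subalg flip: subst_mult)
    show ?thesis
      by (simp only: univ_der_subst delta_rep_mult kaehler_add kaehler_smult delta_rep_carrier subst_in_subalg * flip: subst_mult)
  qed
  have const: "univ_der f (Poly_Mapping.single 0 c) = \<zero>\<^bsub>kaehler f\<^esub>" for c
  proof -
    have "univ_der f (subst f (Poly_Mapping.single 0 c)) = cls (\<lambda>_. 0)"
      unfolding univ_der_subst by (simp add: delta_rep_def)
    then show ?thesis by (simp add: subst_const kaehler_zero)
  qed
  have closed: "univ_der f (subst f F) \<in> carrier (kaehler f)" for F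
    unfolding univ_der_subst kaehler_carrier by (intro imageI delta_rep_carrier)
  show ?thesis
    unfolding derivations_def
  proof (intro CollectI conjI ballI allI Pi_I)
    fix a assume "a \<in> carrier A"
    then obtain F where "a = subst f F" unfolding in_subalg_iff ..
    then show "univ_der f a \<in> carrier (kaehler f)" by (simp only: closed)
  next
    fix a b assume "a \<in> carrier A" "b \<in> carrier A"
    then obtain F G where ab: "a = subst f F" "b = subst f G" unfolding in_subalg_iff by blast
    show "univ_der f (a + b) = univ_der f a \<oplus>\<^bsub>kaehler f\<^esub> univ_der f b"
      unfolding ab by (rule add)
    show "univ_der f (a * b) = (a \<odot>\<^bsub>kaehler f\<^esub> univ_der f b) \<oplus>\<^bsub>kaehler f\<^esub> (b \<odot>\<^bsub>kaehler f\<^esub> univ_der f a)"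
      unfolding ab by (rule mult)
  qed (rule const)
qed

theorem kaehler_universal:
  assumes M: "module A M" and D: "D \<in> derivations f M"
  shows "\<exists>!\<phi>. \<phi> \<in> module_hom A (kaehler f) M \<inter> extensional (carrier (kaehler f)) \<and>
    (\<forall>a\<in>carrier A. \<phi> (univ_der f a) = D a)"
proof -
  interpret M: module A M by (rule M)
  have D_closed: "D (subst f F) \<in> carrier M" for F
    using D by (auto simp: derivations_def subst_in_subalg Pi_iff)
  have D_add: "D (subst f (F + G)) = D (subst f F) \<oplus>\<^bsub>M\<^esub> D (subst f G)" for F G
    using D by (simp add: derivations_def subst_in_subalg subst_add)
  have D_mult: "D (subst f (F * G)) = (subst f F \<odot>\<^bsub>M\<^esub> D (subst f G)) \<oplus>\<^bsub>M\<^esub> (subst f G \<odot>\<^bsub>M\<^esub> D (subst f F))" for F G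
    using D by (simp add: derivations_def subst_in_subalg subst_mult)
  have D_const: "D (subst f (Poly_Mapping.single 0 c)) = \<zero>\<^bsub>M\<^esub>" for c
    using D by (simp add: derivations_def subst_const)
  have D_f: "D (f j) \<in> carrier M" for j
    using D_closed[of "Poly_Mapping.single (Poly_Mapping.single j 1) 1"] by (simp only: subst_var)
  have ops: "a \<oplus>\<^bsub>A\<^esub> b = a + b" "a \<otimes>\<^bsub>A\<^esub> b = a * b" "\<zero>\<^bsub>A\<^esub> = 0" "\<one>\<^bsub>A\<^esub> = 1" for a b
    by (simp_all add: subalg_def class_ring_def)
  define \<Psi> where "\<Psi> v = (\<Oplus>\<^bsub>M\<^esub>j\<in>UNIV. v j \<odot>\<^bsub>M\<^esub> D (f j))" for v
  have rowsD: "v j \<in> carrier A" if "v \<in> rows" for v j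
    using that by (simp add: Pi_iff)
  have term_closed: "v j \<odot>\<^bsub>M\<^esub> D (f j) \<in> carrier M" if "v \<in> rows" for v j
    by (intro M.smult_closed rowsD that D_f)
  have \<Psi>_closed: "\<Psi> v \<in> carrier M" if "v \<in> rows" for v
    unfolding \<Psi>_def by (intro M.M.finsum_closed Pi_I term_closed that)
  have \<Psi>_add: "\<Psi> (\<lambda>j. v j + w j) = \<Psi> v \<oplus>\<^bsub>M\<^esub> \<Psi> w" if v: "v \<in> rows" and w: "w \<in> rows" for v w
  proof -
    have "(v j + w j) \<odot>\<^bsub>M\<^esub> D (f j) = v j \<odot>\<^bsub>M\<^esub> D (f j) \<oplus>\<^bsub>M\<^esub> w j \<odot>\<^bsub>M\<^esub> D (f j)" for j
      using M.smult_l_distr[OF rowsD[OF v] rowsD[OF w] D_f] by (simp only: ops)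
    then have "\<Psi> (\<lambda>j. v j + w j) = (\<Oplus>\<^bsub>M\<^esub>j\<in>UNIV. v j \<odot>\<^bsub>M\<^esub> D (f j) \<oplus>\<^bsub>M\<^esub> w j \<odot>\<^bsub>M\<^esub> D (f j))"
      unfolding \<Psi>_def by (simp only:)
    also have "\<dots> = \<Psi> v \<oplus>\<^bsub>M\<^esub> \<Psi> w"
      unfolding \<Psi>_def by (intro M.M.finsum_addf Pi_I term_closed v w)
    finally show ?thesis .
  qed
  have \<Psi>_smult: "\<Psi> (\<lambda>j. a * v j) = a \<odot>\<^bsub>M\<^esub> \<Psi> v" if a: "a \<in> carrier A" and v: "v \<in> rows" for a v
  proof -
    have "(a * v j) \<odot>\<^bsub>M\<^esub> D (f j) = a \<odot>\<^bsub>M\<^esub> (v j \<odot>\<^bsub>M\<^esub> D (f j))" for j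
      using M.smult_assoc1[OF a rowsD[OF v] D_f] by (simp only: ops)
    then have "\<Psi> (\<lambda>j. a * v j) = (\<Oplus>\<^bsub>M\<^esub>j\<in>UNIV. a \<odot>\<^bsub>M\<^esub> (v j \<odot>\<^bsub>M\<^esub> D (f j)))"
      unfolding \<Psi>_def by (simp only:)
    also have "\<dots> = a \<odot>\<^bsub>M\<^esub> \<Psi> v"
      unfolding \<Psi>_def by (intro M.finsum_smult_ldistr[symmetric] finite Pi_I term_closed a v)
    finally show ?thesis .
  qed
  have \<Psi>_delta: "\<Psi> (delta_rep f F) = D (subst f F)" for F
  proof (induction F rule: mpoly_induct)
    case (const c)
    have "0 \<odot>\<^bsub>M\<^esub> D (f j) = \<zero>\<^bsub>M\<^esub>" for j
      using M.smult_l_null[OF D_f] by (simp only: ops)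
    then have "\<Psi> (\<lambda>_. 0) = \<zero>\<^bsub>M\<^esub>"
      unfolding \<Psi>_def by (simp add: M.M.finsum_zero)
    moreover have "delta_rep f (Poly_Mapping.single 0 c) = (\<lambda>_. 0)"
      by (simp add: delta_rep_def)
    ultimately show ?case by (simp add: D_const)
  next
    case (var i)
    have "0 \<odot>\<^bsub>M\<^esub> D (f j) = \<zero>\<^bsub>M\<^esub>" "1 \<odot>\<^bsub>M\<^esub> D (f j) = D (f j)" for j
      using M.smult_l_null[OF D_f] M.smult_one[OF D_f] by (simp_all only: ops)
    then have "\<Psi> (\<lambda>j. if i = j then 1 else 0) = (\<Oplus>\<^bsub>M\<^esub>j\<in>UNIV. if i = j then D (f j) else \<zero>\<^bsub>M\<^esub>)"
      unfolding \<Psi>_def using D_f by (intro M.M.finsum_cong') auto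
    also have "\<dots> = D (f i)"
      using D_f by (intro M.M.finsum_singleton) auto
    finally show ?case by (simp only: delta_rep_var subst_var)
  next
    case (add F G)
    then show ?case by (simp only: delta_rep_add \<Psi>_add delta_rep_carrier D_add)
  next
    case (mult F G)
    have *: "(\<lambda>j. subst f F * delta_rep f G j) \<in> rows" for F G
      by (simp add: delta_rep_def subst_in_subalg flip: subst_mult)
    from mult show ?case
      by (simp only: delta_rep_mult \<Psi>_add \<Psi>_smult delta_rep_carrier D_mult subst_in_subalg *)
  qed
  have \<Psi>_rep: "\<Psi> u = \<Psi> v" if v: "v \<in> rows" and u: "u \<in> cls v" for u v
  proof -
    obtain F where F: "F \<in> rel_ideal f" "u = (\<lambda>j. delta_rep f F j + v j)"
      using u unfolding coset_free_module delta_image by blast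
    have "D (subst f F) = D (subst f (Poly_Mapping.single 0 0))"
      using F(1) by (simp add: rel_ideal_def)
    then have "\<Psi> (delta_rep f F) = \<zero>\<^bsub>M\<^esub>"
      by (simp only: \<Psi>_delta D_const)
    then show ?thesis
      unfolding F(2) using \<Psi>_add[OF delta_rep_carrier v] \<Psi>_closed[OF v] by simp
  qed
  have cls_self: "v \<in> cls v" for v
  proof -
    have "(\<lambda>_. 0) \<in> delta_rep f ` rel_ideal f"
      by (rule image_eqI[of _ _ 0]) (simp_all add: delta_rep_def rel_ideal_def)
    then show ?thesis
      unfolding coset_free_module delta_image by (rule rev_image_eqI) simp
  qed
  define \<phi> where "\<phi> = (\<lambda>X\<in>carrier (kaehler f). the_elem (\<Psi> ` X))"
  have \<phi>_cls: "\<phi> (cls v) = \<Psi> v" if "v \<in> rows" for v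
  proof -
    have "\<Psi> ` cls v = {\<Psi> v}"
      using \<Psi>_rep[OF that] cls_self[of v] by blast
    moreover have "cls v \<in> carrier (kaehler f)"
      unfolding kaehler_carrier using that by (rule imageI)
    ultimately show ?thesis by (simp only: \<phi>_def restrict_apply if_True the_elem_eq)
  qed
  have rows_add: "(\<lambda>j. v j + w j) \<in> rows" if "v \<in> rows" "w \<in> rows" for v w
    using M.R.a_closed[OF rowsD[OF that(1)] rowsD[OF that(2)]] unfolding ops by (rule Pi_I)
  have rows_smult: "(\<lambda>j. a * v j) \<in> rows" if "a \<in> carrier A" "v \<in> rows" for a v
    using M.R.m_closed[OF that(1) rowsD[OF that(2)]] unfolding ops by (rule Pi_I)
  have hom: "\<phi> \<in> module_hom A (kaehler f) M"
    unfolding module_hom_def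
  proof (intro CollectI conjI ballI Pi_I)
    fix X assume "X \<in> carrier (kaehler f)"
    then obtain v where "v \<in> rows" "X = cls v"
      unfolding kaehler_carrier by blast
    then show "\<phi> X \<in> carrier M" by (simp only: \<phi>_cls \<Psi>_closed)
  next
    fix X Y assume "X \<in> carrier (kaehler f)" "Y \<in> carrier (kaehler f)"
    then obtain v w where "v \<in> rows" "w \<in> rows" "X = cls v" "Y = cls w"
      unfolding kaehler_carrier by blast
    then show "\<phi> (X \<oplus>\<^bsub>kaehler f\<^esub> Y) = \<phi> X \<oplus>\<^bsub>M\<^esub> \<phi> Y"
      by (simp only: kaehler_add \<phi>_cls rows_add \<Psi>_add)
  next
    fix a X assume "a \<in> carrier A" "X \<in> carrier (kaehler f)"
    then obtain v where "a \<in> carrier A" "v \<in> rows" "X = cls v"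
      unfolding kaehler_carrier by blast
    then show "\<phi> (a \<odot>\<^bsub>kaehler f\<^esub> X) = a \<odot>\<^bsub>M\<^esub> \<phi> X"
      by (simp only: kaehler_smult \<phi>_cls rows_smult \<Psi>_smult)
  qed
  have der: "\<phi> (univ_der f a) = D a" if "a \<in> carrier A" for a
  proof -
    obtain F where "a = subst f F" using \<open>a \<in> carrier A\<close> unfolding in_subalg_iff ..
    then show ?thesis by (simp only: univ_der_subst \<phi>_cls delta_rep_carrier \<Psi>_delta)
  qed
  have value_eq: "\<psi> (cls v) = \<Psi> v"
    if \<psi>: "\<psi> \<in> module_hom A (kaehler f) M" "\<forall>a\<in>carrier A. \<psi> (univ_der f a) = D a" and v: "v \<in> rows" for \<psi> v
  proof -
    have mem: "cls w \<in> carrier (kaehler f)" if "w \<in> rows" for w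
      unfolding kaehler_carrier using that by (rule imageI)
    have add: "\<psi> (cls (\<lambda>j. u j + w j)) = \<psi> (cls u) \<oplus>\<^bsub>M\<^esub> \<psi> (cls w)" if u: "u \<in> rows" and w: "w \<in> rows" for u w
    proof -
      have "\<psi> (cls u \<oplus>\<^bsub>kaehler f\<^esub> cls w) = \<psi> (cls u) \<oplus>\<^bsub>M\<^esub> \<psi> (cls w)"
        using \<psi>(1) mem[OF u] mem[OF w] unfolding module_hom_def by blast
      then show ?thesis by (simp only: kaehler_add[OF u w])
    qed
    have smult: "\<psi> (cls (\<lambda>j. a * w j)) = a \<odot>\<^bsub>M\<^esub> \<psi> (cls w)" if a: "a \<in> carrier A" and w: "w \<in> rows" for a w
    proof -
      have "\<psi> (a \<odot>\<^bsub>kaehler f\<^esub> cls w) = a \<odot>\<^bsub>M\<^esub> \<psi> (cls w)"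
        using \<psi>(1) a mem[OF w] unfolding module_hom_def by blast
      then show ?thesis by (simp only: kaehler_smult[OF a w])
    qed
    have closed: "\<psi> (cls w) \<in> carrier M" if "w \<in> rows" for w
      using \<psi>(1) mem[OF that] unfolding module_hom_def by blast
    have A01: "0 \<in> carrier A" "1 \<in> carrier A"
      using M.R.zero_closed M.R.one_closed by (simp_all only: ops)
    then have zero: "(\<lambda>_. 0) \<in> rows" by simp
    have unit: "(\<lambda>j. if i = j then 1 else 0) \<in> rows" for i
      using A01 by simp
    have \<psi>_unit: "\<psi> (cls (\<lambda>j. if i = j then 1 else 0)) = D (f i)" for i
    proof -
      have "\<psi> (univ_der f (subst f (Poly_Mapping.single (Poly_Mapping.single i 1) 1))) = D (subst f (Poly_Mapping.single (Poly_Mapping.single i 1) 1))"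
        using \<psi>(2) subst_in_subalg by blast
      then have "\<psi> (cls (\<lambda>j. if i = j then 1 else 0)) = D (subst f (Poly_Mapping.single (Poly_Mapping.single i 1) 1))"
        unfolding univ_der_subst delta_rep_var .
      then show ?thesis by (simp only: subst_var)
    qed
    have "\<psi> (cls (\<lambda>j. if j \<in> I then v j else 0)) = (\<Oplus>\<^bsub>M\<^esub>j\<in>I. v j \<odot>\<^bsub>M\<^esub> D (f j))" if "finite I" for I
      using that
    proof (induction I)
      case empty
      have "\<psi> (cls (\<lambda>j. 0 * 0)) = 0 \<odot>\<^bsub>M\<^esub> \<psi> (cls (\<lambda>_. 0))"
        using smult[OF M.R.zero_closed zero] by (simp only: ops)
      also have "\<dots> = \<zero>\<^bsub>M\<^esub>"
        using M.smult_l_null[OF closed[OF zero]] by (simp only: ops)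
      finally show ?case by simp
    next
      case (insert i I)
      have vi: "v i \<in> carrier A" using v by (rule rowsD)
      have vI: "(\<lambda>j. if j \<in> I then v j else 0) \<in> rows"
        using rowsD[OF v] A01 by simp
      have "(\<lambda>j. if j \<in> insert i I then v j else 0)
          = (\<lambda>j. v i * (if i = j then 1 else 0) + (if j \<in> I then v j else 0))"
        using insert.hyps by (auto simp: fun_eq_iff)
      then have "\<psi> (cls (\<lambda>j. if j \<in> insert i I then v j else 0))
          = v i \<odot>\<^bsub>M\<^esub> D (f i) \<oplus>\<^bsub>M\<^esub> (\<Oplus>\<^bsub>M\<^esub>j\<in>I. v j \<odot>\<^bsub>M\<^esub> D (f j))"
        by (simp only: add[OF rows_smult[OF vi unit] vI] smult[OF vi unit] \<psi>_unit insert.IH)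
      also have "\<dots> = (\<Oplus>\<^bsub>M\<^esub>j\<in>insert i I. v j \<odot>\<^bsub>M\<^esub> D (f j))"
        by (intro M.M.finsum_insert[symmetric] insert.hyps Pi_I term_closed v)
      finally show ?case .
    qed
    from this[of UNIV] show ?thesis by (simp add: \<Psi>_def)
  qed
  show ?thesis
  proof (rule ex1I[of _ \<phi>])
    show "\<phi> \<in> module_hom A (kaehler f) M \<inter> extensional (carrier (kaehler f)) \<and>
      (\<forall>a\<in>carrier A. \<phi> (univ_der f a) = D a)"
      using hom der by (auto simp: \<phi>_def)
  next
    fix \<psi> assume \<psi>: "\<psi> \<in> module_hom A (kaehler f) M \<inter> extensional (carrier (kaehler f)) \<and>
      (\<forall>a\<in>carrier A. \<psi> (univ_der f a) = D a)"
    show "\<psi> = \<phi>"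
    proof (rule extensionalityI[of _ "carrier (kaehler f)"])
      fix X assume "X \<in> carrier (kaehler f)"
      then obtain v where v: "v \<in> rows" and X: "X = cls v" unfolding kaehler_carrier by blast
      have "\<psi> (cls v) = \<Psi> v"
        using \<psi> by (intro value_eq v) simp_all
      then show "\<psi> X = \<phi> X" by (simp only: X \<phi>_cls v)
    qed (use \<psi> in \<open>auto simp: \<phi>_def\<close>)
  qed
qed

end

end

theory Submission
  imports Defs
begin

text \<open>Let $N \subset A^m$ be the image of \<open>\<delta>\<close> and $Z \subset A^m$ the kernel of the Jacobian on
  rows with entries in $A$; by the chain rule $N \subset Z$. The cokernel of \<open>\<delta>\<close> is the module of
  differentials and the kernel of the Leibniz map is $Z/N$, so both the contraction property and the
  injectivity of the Leibniz map say that $Z = N$. As $A^m/Z$ embeds into $R^n$, it is torsion free, and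
  $Z = N$ makes the module of differentials torsion free. The converse holds because $Z/N$ is a torsion
  module (\<open>jacobian_kernel_torsion\<close>).

  If $A^m/N$ is torsion free, then $N$ is reflexive: an element of the bidual of $N$ is
  given by its values on the $m$ coordinate functions; this row is killed by all linear forms on $A^m$ that
  vanish on $N$, hence has a multiple in $N$ (\<open>double_annihilator\<close>), hence lies in $N$ itself. The
  map \<open>\<delta>\<close> identifies $P/P^{(2)}$ with $N$ since it is injective
  (\<open>rel_ideal2_if_delta_rep_0\<close>). If the tuple is polarizable, the contraction of the polar
  syzygies is the contraction of the differential ones, which gives the last assertion.

  The three facts referred to all come from one construction (\<open>add_variable\<close>). Adjoining the elements
  of a tuple one at a time, and taking a relation of least degree whenever the new element is algebraic over
  the preceding ones, gives a triangular system of relations: it generates the ideal of relations at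
  the generic point, and in characteristic zero its Jacobian matrix at the pivot variables is triangular with
  nonzero diagonal. Elimination with this matrix replaces transcendence bases, separable extensions
  and fields of fractions. For the torsion of $Z/N$ it is applied to the tuple consisting of the $f_j$ and of the
  variables $x_i$.\<close>

section \<open>Polynomials in some of the variables\<close>

definition mvar :: "'v \<Rightarrow> ('v, 'k::comm_ring_1) mpoly" where
  "mvar v = Poly_Mapping.single (Poly_Mapping.single v 1) 1"

lemma subst_mvar [simp]: "subst g (mvar v) = g v"
  unfolding mvar_def by (rule subst_var)

lemma pd_mvar: "pd v (mvar u) = (if u = v then 1 else 0)"
  unfolding mvar_def by (rule pd_var)

lemma subst_diff: "subst g (F - G) = subst g F - subst g G"
  using subst_add[of g F "- G"] by (simp add: subst_uminus)

lemma pd_diff: "pd v (F - G) = pd v F - pd v G"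
  using pd_add[of v F "- G"] by (simp add: pd_uminus)

lemma pd_sum: "pd v (\<Sum>i\<in>I. h i) = (\<Sum>i\<in>I. pd v (h i))"
  by (induction I rule: infinite_finite_induct) (auto simp: pd_add)

lemma pd_mvar_power: "pd v (mvar v ^ n) = of_nat n * mvar v ^ (n - 1)"
proof (induction n)
  case (Suc n)
  show ?case
  proof (cases n)
    case 0
    then show ?thesis by (simp add: pd_mvar)
  next
    case (Suc m)
    with Suc.IH show ?thesis by (simp add: pd_mult pd_mvar algebra_simps)
  qed
qed simp

lemma subst_of_nat: "subst g (of_nat n) = of_nat n"
  by (induction n) (auto simp: subst_add)

lemma subst_subst: "subst g (subst h F) = subst (\<lambda>v. subst g (h v)) F"
proof (induction F rule: mpoly_induct)
  case (var v)
  then show ?case by (simp flip: mvar_def del: One_nat_def)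
qed (simp_all add: subst_const subst_add subst_mult)

lemma subst_mvar_id: "subst mvar F = F"
proof (induction F rule: mpoly_induct)
  case (var v)
  then show ?case by (simp flip: mvar_def del: One_nat_def)
qed (simp_all add: subst_const subst_add subst_mult)

text \<open>The subring $k[T_v : v \in S]$. Generating it inductively, instead of bounding the support of the
  exponents, lets the expansion in powers of a further variable be found by rule induction.\<close>
inductive_set polys_in :: "'v set \<Rightarrow> ('v, 'k::comm_ring_1) mpoly set" for S where
  const: "Poly_Mapping.single 0 c \<in> polys_in S"
| var: "v \<in> S \<Longrightarrow> mvar v \<in> polys_in S"
| add: "F \<in> polys_in S \<Longrightarrow> G \<in> polys_in S \<Longrightarrow> F + G \<in> polys_in S"
| mult: "F \<in> polys_in S \<Longrightarrow> G \<in> polys_in S \<Longrightarrow> F * G \<in> polys_in S"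

lemma polys_in_UNIV: "(F :: ('v::finite, 'k::comm_ring_1) mpoly) \<in> polys_in UNIV"
proof (induction F rule: mpoly_induct)
  case (var v)
  then show ?case by (simp add: polys_in.var flip: mvar_def del: One_nat_def)
qed (auto intro: polys_in.intros)

lemma polys_in_mono: "S \<subseteq> T \<Longrightarrow> (polys_in S :: ('v, 'k::comm_ring_1) mpoly set) \<subseteq> polys_in T"
proof
  fix F :: "('v, 'k) mpoly"
  assume "F \<in> polys_in S" "S \<subseteq> T"
  then show "F \<in> polys_in T" by induction (auto intro: polys_in.intros)
qed

lemma pd_polys_in: "F \<in> polys_in S \<Longrightarrow> v \<notin> S \<Longrightarrow> pd v F = 0"
  by (induction rule: polys_in.induct) (auto simp: pd_mvar pd_add pd_mult)

lemma polys_in_0: "0 \<in> polys_in S"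
  using polys_in.const[of 0] by simp

lemma polys_in_1: "1 \<in> polys_in S"
  using polys_in.const[of 1] by simp

lemma polys_in_of_nat: "of_nat n \<in> polys_in S"
  by (induction n) (auto intro: polys_in_0 polys_in_1 polys_in.add)

lemma polys_in_uminus: "F \<in> polys_in S \<Longrightarrow> - F \<in> polys_in S"
  using polys_in.mult[OF polys_in.const[of "- 1"], of F S]
  by (simp add: single_uminus)

text \<open>Recursion on the degree bound splits off the leading term in $T_a$, which is where pseudo-division acts;
  the coefficients are polynomials in the variables \<open>S\<close>.\<close>
primrec polys_deg_less :: "'v \<Rightarrow> 'v set \<Rightarrow> nat \<Rightarrow> ('v, 'k::comm_ring_1) mpoly set" where
  "polys_deg_less a S 0 = {0}"
| "polys_deg_less a S (Suc n) = {F + c * mvar a ^ n | F c. F \<in> polys_deg_less a S n \<and> c \<in> polys_in S}"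

lemma polys_deg_less_SucI: "F \<in> polys_deg_less a S n \<Longrightarrow> c \<in> polys_in S \<Longrightarrow> F + c * mvar a ^ n \<in> polys_deg_less a S (Suc n)"
  by auto

lemma polys_deg_less_SucE:
  assumes "F \<in> polys_deg_less a S (Suc n)"
  obtains G c where "F = G + c * mvar a ^ n" "G \<in> polys_deg_less a S n" "c \<in> polys_in S"
  using assms by auto

declare polys_deg_less.simps(2) [simp del]

lemma polys_deg_less_step: "F \<in> polys_deg_less a S n \<Longrightarrow> F \<in> polys_deg_less a S (Suc n)"
  using polys_deg_less_SucI[OF _ polys_in_0] by fastforce

lemma polys_deg_less_mono: "n \<le> m \<Longrightarrow> F \<in> polys_deg_less a S n \<Longrightarrow> F \<in> polys_deg_less a S m"
  by (induction m rule: dec_induct) (auto intro: polys_deg_less_step)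

lemma polys_deg_less_add: "F \<in> polys_deg_less a S n \<Longrightarrow> G \<in> polys_deg_less a S n \<Longrightarrow> F + G \<in> polys_deg_less a S n"
proof (induction n arbitrary: F G)
  case (Suc n)
  obtain F' c G' d where "F = F' + c * mvar a ^ n" "F' \<in> polys_deg_less a S n" "c \<in> polys_in S"
    "G = G' + d * mvar a ^ n" "G' \<in> polys_deg_less a S n" "d \<in> polys_in S"
    using Suc.prems by (elim polys_deg_less_SucE) blast
  then show ?case
    using polys_deg_less_SucI[OF Suc.IH polys_in.add, of F' G' c d] by (simp add: algebra_simps)
qed simp

lemma polys_deg_less_smult: "F \<in> polys_deg_less a S n \<Longrightarrow> c \<in> polys_in S \<Longrightarrow> c * F \<in> polys_deg_less a S n"
proof (induction n arbitrary: F)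
  case (Suc n)
  obtain F' d where "F = F' + d * mvar a ^ n" "F' \<in> polys_deg_less a S n" "d \<in> polys_in S"
    using Suc.prems by (elim polys_deg_less_SucE) blast
  then show ?case
    using polys_deg_less_SucI[OF Suc.IH polys_in.mult, of F' c d] Suc.prems(2) by (simp add: algebra_simps)
qed simp

lemma polys_deg_less_shift: "F \<in> polys_deg_less a S n \<Longrightarrow> mvar a ^ m * F \<in> polys_deg_less a S (n + m)"
proof (induction n arbitrary: F)
  case 0
  then show ?case using polys_deg_less_mono[of 0 m 0 a S] by simp
next
  case (Suc n)
  obtain F' d where "F = F' + d * mvar a ^ n" "F' \<in> polys_deg_less a S n" "d \<in> polys_in S"
    using Suc.prems by (elim polys_deg_less_SucE) blast
  then show ?case
    using polys_deg_less_SucI[OF Suc.IH, of F' d] by (simp add: algebra_simps power_add)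
qed

lemma polys_deg_less_mult: "F \<in> polys_deg_less a S n \<Longrightarrow> G \<in> polys_deg_less a S m \<Longrightarrow> F * G \<in> polys_deg_less a S (n + m)"
proof (induction n arbitrary: F)
  case 0
  then show ?case using polys_deg_less_mono[of 0 m 0 a S] by simp
next
  case (Suc n)
  obtain F' d where F: "F = F' + d * mvar a ^ n" "F' \<in> polys_deg_less a S n" "d \<in> polys_in S"
    using Suc.prems by (elim polys_deg_less_SucE) blast
  have "F' * G \<in> polys_deg_less a S (Suc n + m)"
    by (rule polys_deg_less_mono[of "n + m"]) (simp_all add: Suc F)
  moreover have "d * (mvar a ^ n * G) \<in> polys_deg_less a S (Suc n + m)"
    by (rule polys_deg_less_mono[OF _ polys_deg_less_smult[OF polys_deg_less_shift[OF Suc.prems(2)] F(3)]]) simp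
  ultimately have "F' * G + d * (mvar a ^ n * G) \<in> polys_deg_less a S (Suc n + m)"
    by (rule polys_deg_less_add)
  then show ?case by (simp add: F algebra_simps)
qed

lemma pd_polys_deg_less:
  assumes "a \<notin> S" "F \<in> polys_deg_less a S (Suc n)" shows "pd a F \<in> polys_deg_less a S n"
  using assms(2)
proof (induction n arbitrary: F)
  case 0
  then obtain c where "F = c" "c \<in> polys_in S" by (auto elim: polys_deg_less_SucE)
  with assms(1) show ?case by (simp add: pd_polys_in)
next
  case (Suc n)
  obtain F' d where F: "F = F' + d * mvar a ^ Suc n" "F' \<in> polys_deg_less a S (Suc n)" "d \<in> polys_in S"
    using Suc.prems by (rule polys_deg_less_SucE)
  have "pd a F = pd a F' + (of_nat (Suc n) * d) * mvar a ^ n"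
    by (simp only: F(1) pd_add pd_mult pd_polys_in[OF F(3) assms(1)] pd_mvar_power diff_Suc_1 mult_ac mult_zero_left mult_zero_right add_0)
  then show ?case
    by (simp only: polys_deg_less_SucI Suc.IH F polys_in.mult polys_in_of_nat)
qed

lemma polys_in_insert: "F \<in> polys_in (insert a S) \<Longrightarrow> \<exists>n. F \<in> polys_deg_less a S n"
proof (induction rule: polys_in.induct)
  case (const c)
  show ?case
    using polys_deg_less_SucI[of 0 a S 0, OF _ polys_in.const] by auto
next
  case (var v)
  show ?case
  proof (cases "v = a")
    case True
    have "0 + 1 * mvar a ^ 1 \<in> polys_deg_less a S (Suc 1)"
      using polys_deg_less_mono[of 0 1 0 a S] by (intro polys_deg_less_SucI polys_in_1) simp
    with True show ?thesis by auto
  next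
    case False
    with var have "mvar v \<in> polys_in S" by (auto intro: polys_in.var)
    then show ?thesis
      using polys_deg_less_SucI[of 0 a S 0] by fastforce
  qed
next
  case (add F G)
  then obtain n m where "F \<in> polys_deg_less a S n" "G \<in> polys_deg_less a S m" by blast
  then have "F + G \<in> polys_deg_less a S (max n m)"
    by (intro polys_deg_less_add) (auto elim: polys_deg_less_mono[rotated])
  then show ?case ..
next
  case (mult F G)
  then show ?case by (blast intro: polys_deg_less_mult)
qed

lemma polys_deg_less_polys_in: "F \<in> polys_deg_less a S n \<Longrightarrow> F \<in> polys_in (insert a S)"
proof (induction n arbitrary: F)
  case 0
  then show ?case by (simp add: polys_in_0)
next
  case (Suc n)
  have "mvar a ^ k \<in> polys_in (insert a S)" for k
    by (induction k) (auto intro: polys_in.intros polys_in_1)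
  with Suc show ?case
    by (auto elim!: polys_deg_less_SucE intro!: polys_in.add polys_in.mult intro: subsetD[OF polys_in_mono[of S "insert a S"]])
qed

section \<open>Triangular systems of relations\<close>

text \<open>This is the ideal generated by the list; the recursion exposes the coefficient of the first
  generator, which is the one that elimination treats first.\<close>
primrec combinations :: "'a::comm_ring_1 list \<Rightarrow> 'a set" where
  "combinations [] = {0}"
| "combinations (F # Fs) = {Q * F + H | Q H. H \<in> combinations Fs}"

lemma combinations_ConsI: "H \<in> combinations Fs \<Longrightarrow> Q * F + H \<in> combinations (F # Fs)"
  by auto

lemma combinations_ConsE:
  assumes "G \<in> combinations (F # Fs)"
  obtains Q H where "G = Q * F + H" "H \<in> combinations Fs"
  using assms by auto

declare combinations.simps(2) [simp del]

lemma combinations_Cons: "H \<in> combinations Fs \<Longrightarrow> H \<in> combinations (F # Fs)"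
  using combinations_ConsI[of H Fs 0 F] by simp

lemma combinations_0: "0 \<in> combinations Fs"
  by (induction Fs) (auto intro: combinations_Cons)

lemma combinations_member: "F \<in> combinations (F # Fs)"
  using combinations_ConsI[OF combinations_0, of 1 F Fs] by simp

lemma combinations_add: "G \<in> combinations Fs \<Longrightarrow> H \<in> combinations Fs \<Longrightarrow> G + H \<in> combinations Fs"
proof (induction Fs arbitrary: G H)
  case (Cons F Fs)
  obtain P G' Q H' where *: "G = P * F + G'" "H = Q * F + H'" "G' \<in> combinations Fs" "H' \<in> combinations Fs"
    using Cons.prems by (elim combinations_ConsE) blast
  have "G + H = (P + Q) * F + (G' + H')"
    unfolding * by (simp add: algebra_simps)
  with Cons.IH[OF *(3,4)] show ?case by (simp only: combinations_ConsI)
qed simp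

lemma combinations_mult: "G \<in> combinations Fs \<Longrightarrow> P * G \<in> combinations Fs"
proof (induction Fs arbitrary: G)
  case (Cons F Fs)
  obtain Q H where *: "G = Q * F + H" "H \<in> combinations Fs"
    using Cons.prems by (rule combinations_ConsE)
  have "P * G = (P * Q) * F + P * H"
    unfolding * by (simp add: algebra_simps)
  with Cons.IH[OF *(2)] show ?case by (simp only: combinations_ConsI)
qed simp

lemma combinations_rel_ideal:
  "set Fs \<subseteq> rel_ideal g \<Longrightarrow> H \<in> combinations Fs \<Longrightarrow> H \<in> rel_ideal g"
proof (induction Fs arbitrary: H)
  case Nil
  then show ?case by (simp add: rel_ideal_def)
next
  case (Cons F Fs)
  obtain Q H' where "H = Q * F + H'" "H' \<in> combinations Fs"
    using Cons.prems(2) by (rule combinations_ConsE)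
  with Cons show ?case by (simp add: rel_ideal_def subst_add subst_mult)
qed

lemma combinations_subst: "H \<in> combinations Fs \<Longrightarrow> subst h H \<in> combinations (map (subst h) Fs)"
proof (induction Fs arbitrary: H)
  case (Cons F Fs)
  obtain Q H' where "H = Q * F + H'" "H' \<in> combinations Fs"
    using Cons.prems by (rule combinations_ConsE)
  with Cons.IH[of H'] show ?case by (simp add: subst_add subst_mult combinations_ConsI)
qed simp

text \<open>Each entry \<open>(a, F)\<close> is a relation \<open>F\<close> among the \<open>g v\<close> with a pivot: its derivative
  with respect to \<open>a\<close> is nonzero at \<open>g\<close>, while the relations further down the list do not
  involve \<open>a\<close>. Evaluated at \<open>g\<close>, the gradients of the relations thus form a triangular matrix
  with nonzero diagonal in the columns of the pivots.\<close>
primrec pivoted :: "('v::finite \<Rightarrow> ('n, 'k::comm_ring_1) mpoly) \<Rightarrow> ('v \<times> ('v, 'k) mpoly) list \<Rightarrow> bool" where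
  "pivoted g [] \<longleftrightarrow> True"
| "pivoted g (aF # B) \<longleftrightarrow> subst g (snd aF) = 0 \<and> subst g (pd (fst aF) (snd aF)) \<noteq> 0 \<and>
     (\<forall>G\<in>snd ` set B. pd (fst aF) G = 0) \<and> pivoted g B"

lemma pivoted_rel_ideal: "pivoted g B \<Longrightarrow> snd ` set B \<subseteq> rel_ideal g"
  by (induction B) (auto simp: rel_ideal_def)

lemma pd_combinations:
  assumes "\<forall>F\<in>set Fs. subst g F = 0 \<and> pd a F = 0" "H \<in> combinations Fs"
  shows "subst g (pd a H) = 0"
  using assms
proof (induction Fs arbitrary: H)
  case (Cons F Fs)
  obtain Q H' where "H = Q * F + H'" "H' \<in> combinations Fs"
    using Cons.prems(2) by (rule combinations_ConsE)
  with Cons show ?case by (simp add: pd_add pd_mult subst_add subst_mult)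
qed simp

text \<open>Polynomials that lie in the ideal generated by \<open>Fs\<close> once the denominators prime to the ideal of
  relations are inverted; when that ideal is prime, this is the contraction of the ideal generated by
  \<open>Fs\<close> in the localization.\<close>
definition saturation :: "('v::finite \<Rightarrow> ('n, 'k::comm_ring_1) mpoly) \<Rightarrow> ('v, 'k) mpoly list \<Rightarrow> ('v, 'k) mpoly set" where
  "saturation g Fs = {F. \<exists>s. subst g s \<noteq> 0 \<and> s * F \<in> combinations Fs}"

lemma saturationI: "subst g s \<noteq> 0 \<Longrightarrow> s * F \<in> combinations Fs \<Longrightarrow> F \<in> saturation g Fs"
  unfolding saturation_def by blast

lemma saturationE:
  assumes "F \<in> saturation g Fs"
  obtains s where "subst g s \<noteq> 0" "s * F \<in> combinations Fs"
  using assms unfolding saturation_def by blast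

lemma combinations_saturation: "F \<in> combinations Fs \<Longrightarrow> F \<in> saturation g Fs"
  by (rule saturationI[of g 1]) simp_all

lemma saturation_add:
  fixes g :: "'v::finite \<Rightarrow> ('n::linorder, 'k::idom) mpoly"
  assumes "F \<in> saturation g Fs" "G \<in> saturation g Fs"
  shows "F + G \<in> saturation g Fs"
proof -
  obtain s t where s: "subst g s \<noteq> 0" "s * F \<in> combinations Fs"
    and t: "subst g t \<noteq> 0" "t * G \<in> combinations Fs"
    using assms by (elim saturationE) blast
  show ?thesis
  proof (rule saturationI)
    show "subst g (s * t) \<noteq> 0" using s t by (simp add: subst_mult)
    have "t * (s * F) + s * (t * G) \<in> combinations Fs"
      by (intro combinations_add combinations_mult s t)
    then show "s * t * (F + G) \<in> combinations Fs" by (simp add: algebra_simps)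
  qed
qed

lemma saturation_mult:
  assumes "F \<in> saturation g Fs" shows "Q * F \<in> saturation g Fs"
  using assms
proof (rule saturationE)
  fix s assume s: "subst g s \<noteq> 0" "s * F \<in> combinations Fs"
  have "Q * (s * F) \<in> combinations Fs" by (intro combinations_mult s)
  then show ?thesis using s(1) by (intro saturationI[of g s]) (simp_all add: ac_simps)
qed

lemma saturation_cancel:
  fixes g :: "'v::finite \<Rightarrow> ('n::linorder, 'k::idom) mpoly"
  assumes "t * F \<in> saturation g Fs" "subst g t \<noteq> 0"
  shows "F \<in> saturation g Fs"
  using assms(1)
proof (rule saturationE)
  fix s assume "subst g s \<noteq> 0" "s * (t * F) \<in> combinations Fs"
  then show ?thesis
    using assms(2) by (intro saturationI[of g "s * t"]) (simp_all add: subst_mult mult.assoc)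
qed

text \<open>A pivoted list that generates the relations in the variables \<open>S\<close> at the generic point.\<close>
definition triangular where
  "triangular g S B \<longleftrightarrow> pivoted g B \<and> snd ` set B \<subseteq> polys_in S \<and>
    polys_in S \<inter> rel_ideal g \<subseteq> saturation g (map snd B)"

lemma triangularD:
  "triangular g S B \<Longrightarrow> F \<in> polys_in S \<Longrightarrow> subst g F = 0 \<Longrightarrow> F \<in> saturation g (map snd B)"
  unfolding triangular_def rel_ideal_def by blast

text \<open>Pseudo-division in one variable. If some relation in $k[T_v : v \in S][T_a]$ has a leading coefficient
  that does not vanish at \<open>g\<close>, one of least degree \<open>d\<close> in $T_a$ is the new generator \<open>F0\<close>.
  Its derivative is not a relation: it has degree \<open>d - 1\<close> and leading coefficient \<open>d * c0\<close>, which
  does not vanish in characteristic zero. A relation of degree below \<open>d\<close> has all its coefficients in the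
  ideal of relations, hence is generated by the old list; a relation of higher degree is reduced by
  subtracting multiples of \<open>F0\<close>, at the price of multiplying it by \<open>c0\<close>. If there is no such
  relation, the element \<open>g a\<close> is transcendental over the preceding ones and the list is kept.\<close>
lemma add_variable:
  fixes g :: "'v::finite \<Rightarrow> ('n::linorder, 'k::field_char_0) mpoly"
  assumes B: "triangular g S B" and a: "a \<notin> S"
  shows "\<exists>C. fst ` set C \<subseteq> {a} \<and> triangular g (insert a S) (C @ B)"
proof -
  have gen_insert: "polys_in (insert a S) \<inter> rel_ideal g \<subseteq> saturation g Fs"
    if *: "\<And>n F. F \<in> polys_deg_less a S n \<Longrightarrow> subst g F = 0 \<Longrightarrow> F \<in> saturation g Fs" for Fs
    using polys_in_insert[of _ a S] * unfolding rel_ideal_def by blast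
  have B_S: "pivoted g B" "snd ` set B \<subseteq> polys_in S"
    using B unfolding triangular_def by auto
  have B_insert: "snd ` set B \<subseteq> polys_in (insert a S)"
    using B_S(2) polys_in_mono[of S "insert a S"] by blast
  \<comment> \<open>The degrees of the relations whose leading coefficient survives evaluation.\<close>
  define top where "top d \<longleftrightarrow> (\<exists>c\<in>polys_in S. \<exists>G\<in>polys_deg_less a S d. subst g c \<noteq> 0 \<and> subst g (G + c * mvar a ^ d) = 0)" for d
  have low: "F \<in> saturation g (map snd B)" if "\<And>d. d < n \<Longrightarrow> \<not> top d" "F \<in> polys_deg_less a S n" "subst g F = 0" for n F
    using that
  proof (induction n arbitrary: F)
    case 0
    then show ?case by (simp add: combinations_saturation combinations_0)
  next
    case (Suc n)
    obtain G c where F: "F = G + c * mvar a ^ n" "G \<in> polys_deg_less a S n" "c \<in> polys_in S"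
      using Suc.prems(2) by (elim polys_deg_less_SucE) blast
    have c: "subst g c = 0"
      using Suc.prems(1)[of n] Suc.prems(3) F unfolding top_def by blast
    then have "subst g G = 0"
      using Suc.prems(3) by (simp add: F subst_add subst_mult)
    then have "G \<in> saturation g (map snd B)"
      using Suc.prems(1) F(2) by (intro Suc.IH) auto
    moreover have "mvar a ^ n * c \<in> saturation g (map snd B)"
      using triangularD[OF B F(3) c] by (rule saturation_mult)
    ultimately show ?case
      unfolding F(1) by (subst mult.commute) (rule saturation_add)
  qed
  show ?thesis
  proof (cases "\<exists>d. top d")
    case False
    have "polys_in (insert a S) \<inter> rel_ideal g \<subseteq> saturation g (map snd B)"
      using low False by (intro gen_insert) auto
    then have "triangular g (insert a S) ([] @ B)"
      using B_S(1) B_insert unfolding triangular_def by simp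
    then show ?thesis by (intro exI[of _ "[]"]) simp
  next
    case True
    define d where "d = (LEAST d. top d)"
    have d: "top d" and least: "\<And>e. e < d \<Longrightarrow> \<not> top e"
      unfolding d_def using True by (auto intro: LeastI_ex dest: not_less_Least)
    obtain c0 G0 where c0: "c0 \<in> polys_in S" "subst g c0 \<noteq> 0" and G0: "G0 \<in> polys_deg_less a S d"
      and rel: "subst g (G0 + c0 * mvar a ^ d) = 0"
      using d unfolding top_def by blast
    define F0 where "F0 = G0 + c0 * mvar a ^ d"
    have "d \<noteq> 0"
    proof
      assume "d = 0"
      then have "G0 = 0" using G0 by simp
      with rel c0(2) \<open>d = 0\<close> show False by (simp add: subst_mult)
    qed
    from not0_implies_Suc[OF this] obtain e where e: "d = Suc e" ..
    have pivot: "subst g (pd a F0) \<noteq> 0"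
    proof
      assume *: "subst g (pd a F0) = 0"
      have "pd a F0 = pd a G0 + (of_nat (Suc e) * c0) * mvar a ^ e"
        unfolding F0_def e
        by (simp only: pd_add pd_mult pd_polys_in[OF c0(1) a] pd_mvar_power diff_Suc_1 mult_ac mult_zero_left mult_zero_right add_0)
      moreover have "pd a G0 \<in> polys_deg_less a S e"
        using G0 a by (intro pd_polys_deg_less) (simp_all add: e)
      moreover have "of_nat (Suc e) * c0 \<in> polys_in S"
        by (intro polys_in.mult polys_in_of_nat c0)
      moreover have "subst g (of_nat (Suc e) * c0) \<noteq> 0"
        using c0(2) by (simp only: subst_mult subst_of_nat mult_eq_0_iff of_nat_eq_0_iff nat.distinct simp_thms)
      ultimately have "top e"
        using * unfolding top_def by metis
      then show False using least[of e] by (simp add: e)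
    qed
    let ?Fs = "F0 # map snd B"
    have sub: "F \<in> saturation g ?Fs" if "F \<in> saturation g (map snd B)" for F
      using that by (elim saturationE) (rule saturationI, assumption, rule combinations_Cons)
    have F0: "F0 \<in> saturation g ?Fs"
      by (rule combinations_saturation[OF combinations_member])
    have "F \<in> saturation g ?Fs" if "F \<in> polys_deg_less a S n" "subst g F = 0" for n F
      using that
    proof (induction n arbitrary: F)
      case 0
      then show ?case by (simp add: combinations_saturation[OF combinations_0])
    next
      case (Suc n)
      show ?case
      proof (cases "Suc n \<le> d")
        case True
        then show ?thesis using Suc.prems least by (intro sub low[of "Suc n"]) auto
      next
        case False
        obtain G c where F: "F = G + c * mvar a ^ n" "G \<in> polys_deg_less a S n" "c \<in> polys_in S"
          using Suc.prems(1) by (elim polys_deg_less_SucE) blast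
        \<comment> \<open>The leading terms cancel, so that \<open>H\<close> is a relation of smaller degree.\<close>
        define H where "H = c0 * F - c * mvar a ^ (n - d) * F0"
        have nd: "d + (n - d) = n" using False by simp
        have pow: "(mvar a :: ('v, 'k) mpoly) ^ n = mvar a ^ d * mvar a ^ (n - d)"
          unfolding power_add[symmetric] nd ..
        have H: "H = c0 * G + (- c) * (mvar a ^ (n - d) * G0)"
          unfolding H_def F(1) F0_def pow by (simp only: algebra_simps mult_minus_left) simp
        have "mvar a ^ (n - d) * G0 \<in> polys_deg_less a S n"
          using polys_deg_less_shift[OF G0, of "n - d"] by (simp only: nd)
        then have "H \<in> polys_deg_less a S n"
          unfolding H using F(2,3) c0(1) by (simp only: polys_deg_less_add polys_deg_less_smult polys_in_uminus)
        moreover have "subst g H = 0"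
          using Suc.prems(2) rel unfolding H_def F0_def by (simp add: subst_diff subst_mult)
        ultimately have "H \<in> saturation g ?Fs" by (rule Suc.IH)
        then have "H + c * mvar a ^ (n - d) * F0 \<in> saturation g ?Fs"
          by (intro saturation_add saturation_mult F0)
        then have "c0 * F \<in> saturation g ?Fs" by (simp add: H_def)
        then show ?thesis using c0(2) by (rule saturation_cancel)
      qed
    qed
    then have "polys_in (insert a S) \<inter> rel_ideal g \<subseteq> saturation g ?Fs"
      by (rule gen_insert)
    moreover have "pivoted g ((a, F0) # B)"
      using B_S a rel pivot by (auto simp: F0_def pd_polys_in)
    moreover have "F0 \<in> polys_in (insert a S)"
      unfolding F0_def by (rule polys_deg_less_polys_in[OF polys_deg_less_SucI[OF G0 c0(1)]])
    ultimately have "triangular g (insert a S) ([(a, F0)] @ B)"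
      using B_insert unfolding triangular_def by simp
    then show ?thesis by (intro exI[of _ "[(a, F0)]"]) simp
  qed
qed

lemma add_variables:
  fixes g :: "'v::finite \<Rightarrow> ('n::linorder, 'k::field_char_0) mpoly"
  assumes "finite T" "triangular g S B" "S \<inter> T = {}"
  shows "\<exists>C. fst ` set C \<subseteq> T \<and> triangular g (S \<union> T) (C @ B)"
  using assms(1,3)
proof (induction T rule: finite_induct)
  case empty
  then show ?case using assms(2) by (intro exI[of _ "[]"]) auto
next
  case (insert a T)
  then obtain C where C: "fst ` set C \<subseteq> T" "triangular g (S \<union> T) (C @ B)"
    by auto
  moreover have "a \<notin> S \<union> T" using insert by auto
  ultimately obtain C' where "fst ` set C' \<subseteq> {a}" "triangular g (insert a (S \<union> T)) (C' @ C @ B)"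
    using add_variable[OF C(2)] by blast
  with C(1) show ?case by (intro exI[of _ "C' @ C"]) auto
qed

text \<open>If the derivatives of a combination with respect to the pivots of \<open>C\<close> vanish at \<open>g\<close>, the
  triangular shape forces the coefficients of the relations in \<open>C\<close> to vanish at \<open>g\<close> one
  after the other, so each of these terms is a product of two relations. Only a part \<open>C\<close> of
  the list is treated, because below the pivots in the variables $x_i$ have to be removed from a list that also has pivots in the variables $T_j$.\<close>
lemma eliminate_pivots:
  fixes g :: "'v::finite \<Rightarrow> ('n::linorder, 'k::field_char_0) mpoly"
  assumes "pivoted g (C @ B)" "H \<in> combinations (map snd (C @ B))" "\<forall>l\<in>fst ` set C. subst g (pd l H) = 0"
  shows "\<exists>H'\<in>combinations (map snd B). H - H' \<in> ideal_prod poly_ring (rel_ideal g) (rel_ideal g)"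
  using assms
proof (induction C arbitrary: H)
  case Nil
  have "0 \<otimes>\<^bsub>poly_ring\<^esub> 0 \<in> ideal_prod poly_ring (rel_ideal g) (rel_ideal g)"
    by (rule ideal_prod.prod) (auto simp: rel_ideal_def)
  with Nil show ?case by (intro bexI[of _ H]) (auto simp: class_ring_def)
next
  case (Cons aF C)
  obtain a F where aF: "aF = (a, F)" by fastforce
  obtain Q K where H: "H = Q * F + K" "K \<in> combinations (map snd (C @ B))"
    using Cons.prems(2) by (auto simp: aF elim: combinations_ConsE)
  have piv: "subst g F = 0" "subst g (pd a F) \<noteq> 0" "\<forall>G\<in>set (map snd (C @ B)). subst g G = 0 \<and> pd a G = 0"
    using Cons.prems(1) pivoted_rel_ideal[of g "C @ B"] by (auto simp: aF rel_ideal_def)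
  have "subst g Q * subst g (pd a F) = 0"
    using Cons.prems(3) pd_combinations[OF piv(3) H(2)] piv(1) by (simp add: aF H(1) pd_add pd_mult subst_add subst_mult)
  then have Q: "subst g Q = 0" using piv(2) by simp
  have "subst g (pd l K) = 0" if "l \<in> fst ` set C" for l
    using Cons.prems(3) that Q piv(1) by (auto simp: aF H(1) pd_add pd_mult subst_add subst_mult)
  then obtain H' where H': "H' \<in> combinations (map snd B)" "K - H' \<in> ideal_prod poly_ring (rel_ideal g) (rel_ideal g)"
    using Cons.IH[OF _ H(2)] Cons.prems(1) by auto
  have "Q \<otimes>\<^bsub>poly_ring\<^esub> F \<oplus>\<^bsub>poly_ring\<^esub> (K - H') \<in> ideal_prod poly_ring (rel_ideal g) (rel_ideal g)"
    using Q piv(1) by (intro ideal_prod.sum[OF ideal_prod.prod H'(2)]) (auto simp: rel_ideal_def)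
  then show ?case using H'(1) by (intro bexI[of _ H']) (auto simp: class_ring_def H(1) algebra_simps)
qed

lemma delta_rep_ideal_prod:
  fixes g :: "'v::finite \<Rightarrow> ('n::linorder, 'k::field_char_0) mpoly"
  assumes "H \<in> ideal_prod poly_ring (rel_ideal g) (rel_ideal g)"
  shows "subst g (pd l H) = 0"
proof -
  have "H \<in> rel_ideal2 g"
    unfolding rel_ideal2_iff using assms by (intro exI[of _ 1]) (auto simp: rel_ideal_def)
  from fun_cong[OF rel_ideal2D(2)[OF this], of l] show ?thesis by (simp add: delta_rep_def)
qed

text \<open>Starting from no variables, where the only relation is 0.\<close>
lemma triangular_system:
  fixes g :: "'v::finite \<Rightarrow> ('n::linorder, 'k::field_char_0) mpoly"
  obtains B where "triangular g UNIV B"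
proof -
  have "polys_in {} \<inter> rel_ideal g \<subseteq> saturation g (map snd [])"
  proof
    fix F :: "('v, 'k) mpoly" assume "F \<in> polys_in {} \<inter> rel_ideal g"
    then have "F \<in> polys_in {}" "subst g F = 0" by (simp_all add: rel_ideal_def)
    have "\<exists>c. F = Poly_Mapping.single 0 c"
      using \<open>F \<in> polys_in {}\<close>
      by induction (auto simp: mult_single simp flip: single_add)
    then obtain c where c: "F = Poly_Mapping.single 0 c" ..
    with \<open>subst g F = 0\<close> have "Poly_Mapping.single 0 c = (0 :: ('n, 'k) mpoly)"
      by (simp only: subst_const)
    then have "c = 0" by (metis lookup_single_eq lookup_zero)
    then show "F \<in> saturation g (map snd [])"
      by (intro combinations_saturation) (simp add: c)
  qed
  then have "triangular g {} []" unfolding triangular_def by simp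
  with add_variables[of UNIV g "{}" "[]"] obtain B where "triangular g UNIV B" by auto
  then show ?thesis by (rule that)
qed

section \<open>Linear algebra over the subalgebra\<close>

lemma range_subst_closed:
  "0 \<in> range (subst f)" "1 \<in> range (subst f)"
  "a \<in> range (subst f) \<Longrightarrow> b \<in> range (subst f) \<Longrightarrow> a + b \<in> range (subst f)"
  "a \<in> range (subst f) \<Longrightarrow> b \<in> range (subst f) \<Longrightarrow> a - b \<in> range (subst f)"
  "a \<in> range (subst f) \<Longrightarrow> b \<in> range (subst f) \<Longrightarrow> a * b \<in> range (subst f)"
  by (auto simp flip: subst_add subst_diff subst_mult) (metis subst_zero rangeI, metis subst_one rangeI)

lemma range_subst_sum:
  "(\<And>i. i \<in> I \<Longrightarrow> h i \<in> range (subst f)) \<Longrightarrow> (\<Sum>i\<in>I. h i) \<in> range (subst f)"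
  by (induction I rule: infinite_finite_induct) (auto intro: range_subst_closed)

text \<open>Gaussian elimination with the gradients of a pivoted list: up to a common denominator, every row over
  \<open>A\<close> agrees at the pivots with the gradient of a relation.\<close>
lemma clear_pivots:
  fixes f :: "'m::finite \<Rightarrow> ('n::linorder, 'k::field_char_0) mpoly"
  assumes "pivoted f B" "range v \<subseteq> range (subst f)"
  shows "\<exists>p H. subst f p \<noteq> 0 \<and> H \<in> combinations (map snd B) \<and>
    (\<forall>l\<in>fst ` set B. subst f p * v l = subst f (pd l H))"
  using assms
proof (induction B arbitrary: v)
  case Nil
  then show ?case by (intro exI[of _ 1] exI[of _ 0]) simp
next
  case (Cons aF B)
  obtain a F where aF: "aF = (a, F)" by fastforce
  have F: "subst f F = 0" "subst f (pd a F) \<noteq> 0" and B: "pivoted f B"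
    and a: "\<forall>G\<in>set (map snd B). subst f G = 0 \<and> pd a G = 0"
    using Cons.prems(1) pivoted_rel_ideal[of f B] by (auto simp: aF rel_ideal_def)
  obtain V where V: "v a = subst f V" using Cons.prems(2) by blast
  define v' where "v' l = subst f (pd a F) * v l - subst f V * subst f (pd l F)" for l
  have "range v' \<subseteq> range (subst f)"
    using Cons.prems(2) by (auto simp: v'_def intro!: range_subst_closed)
  then obtain p H where p: "subst f p \<noteq> 0" and H: "H \<in> combinations (map snd B)"
    and l: "\<forall>l\<in>fst ` set B. subst f p * v' l = subst f (pd l H)"
    using Cons.IH[OF B] by blast
  have "subst f (p * pd a F) * v l = subst f (pd l (p * V * F + H))" if "l \<in> fst ` set (aF # B)" for l
  proof -
    have "subst f p * v' l = subst f (pd l H)"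
    proof (cases "l \<in> fst ` set B")
      case False
      with that have "l = a" by (auto simp: aF)
      then show ?thesis using pd_combinations[OF a H] V by (simp add: v'_def)
    qed (use l in blast)
    then show ?thesis by (simp add: v'_def pd_add pd_mult subst_add subst_mult F(1) algebra_simps)
  qed
  moreover have "p * V * F + H \<in> combinations (map snd (aF # B))"
    using combinations_ConsI[OF H] by (simp add: aF)
  moreover have "subst f (p * pd a F) \<noteq> 0" using p F(2) by (simp add: subst_mult)
  ultimately show ?case by blast
qed

text \<open>The dual elimination: up to a common denominator, a linear form on \<open>A\<close>-rows may be prescribed
  both on the gradients of the list and on the unit vectors that are not pivots.\<close>
lemma prescribe_values:
  fixes f :: "'m::finite \<Rightarrow> ('n::linorder, 'k::field_char_0) mpoly"
  assumes "pivoted f B" "\<And>F. F \<in> snd ` set B \<Longrightarrow> c F \<in> range (subst f)" "range \<mu> \<subseteq> range (subst f)"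
  shows "\<exists>s\<in>range (subst f). \<exists>\<xi>. s \<noteq> 0 \<and> range \<xi> \<subseteq> range (subst f) \<and>
    (\<forall>F\<in>snd ` set B. (\<Sum>j\<in>UNIV. \<xi> j * delta_rep f F j) = s * c F) \<and> (\<forall>j. j \<notin> fst ` set B \<longrightarrow> \<xi> j = s * \<mu> j)"
  using assms(1,2)
proof (induction B)
  case Nil
  then show ?case using assms(3) by (intro bexI[of _ 1] exI[of _ \<mu>]) (auto intro: range_subst_closed)
next
  case (Cons aF B)
  obtain a F where aF: "aF = (a, F)" by fastforce
  let ?e = "delta_rep f F a"
  have e: "?e \<noteq> 0" "?e \<in> range (subst f)"
    using Cons.prems(1) by (auto simp: aF delta_rep_def)
  have a: "\<forall>G\<in>snd ` set B. delta_rep f G a = 0"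
    using Cons.prems(1) by (auto simp: aF delta_rep_def)
  obtain s \<xi> where s: "s \<in> range (subst f)" "s \<noteq> 0" and \<xi>: "range \<xi> \<subseteq> range (subst f)"
    "\<forall>G\<in>snd ` set B. (\<Sum>j\<in>UNIV. \<xi> j * delta_rep f G j) = s * c G" "\<forall>j. j \<notin> fst ` set B \<longrightarrow> \<xi> j = s * \<mu> j"
    using Cons by (auto simp: aF)
  define u where "u = s * c F - (\<Sum>j\<in>UNIV. \<xi> j * delta_rep f F j)"
  define \<xi>' where "\<xi>' j = ?e * \<xi> j + (if j = a then u else 0)" for j
  have u: "u \<in> range (subst f)"
    using s(1) \<xi>(1) Cons.prems(2)[of F] unfolding u_def
    by (intro range_subst_closed range_subst_sum) (auto simp: aF delta_rep_def)
  have sum: "(\<Sum>j\<in>UNIV. \<xi>' j * delta_rep f G j) = ?e * (\<Sum>j\<in>UNIV. \<xi> j * delta_rep f G j) + u * delta_rep f G a" for G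
  proof -
    have "(\<Sum>j\<in>UNIV. \<xi>' j * delta_rep f G j) =
        (\<Sum>j\<in>UNIV. ?e * (\<xi> j * delta_rep f G j) + (if a = j then u * delta_rep f G j else 0))"
      by (intro sum.cong) (auto simp: \<xi>'_def algebra_simps)
    then show ?thesis by (simp add: sum.distrib sum_distrib_left)
  qed
  have "(\<Sum>j\<in>UNIV. \<xi>' j * delta_rep f G j) = (?e * s) * c G" if "G \<in> snd ` set (aF # B)" for G
  proof (cases "G \<in> snd ` set B")
    case True
    then show ?thesis using bspec[OF a True] bspec[OF \<xi>(2) True] by (simp add: sum)
  next
    case False
    then have "G = F" using that by (auto simp: aF)
    then show ?thesis by (simp add: sum u_def algebra_simps)
  qed
  moreover have "range \<xi>' \<subseteq> range (subst f)"
    using \<xi>(1) u e(2) by (auto simp: \<xi>'_def intro!: range_subst_closed)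
  moreover have "\<xi>' j = (?e * s) * \<mu> j" if "j \<notin> fst ` set (aF # B)" for j
    using \<xi>(3) that by (simp add: aF \<xi>'_def)
  moreover have "?e * s \<noteq> 0" "?e * s \<in> range (subst f)"
    using e s by (auto intro: range_subst_closed)
  ultimately show ?case by (intro bexI[of _ "?e * s"] exI[of _ \<xi>']) auto
qed

text \<open>The \<open>A\<close>-linear functions on $P/P^2$, seen on representatives in $P$.\<close>
definition linear_on_relations where
  "linear_on_relations f \<phi> \<longleftrightarrow>
    (\<forall>F\<in>rel_ideal f. \<forall>G\<in>rel_ideal f. \<phi> (F + G) = \<phi> F + \<phi> G) \<and>
    (\<forall>Q. \<forall>F\<in>rel_ideal f. \<phi> (Q * F) = subst f Q * \<phi> F)"

text \<open>The list generates the ideal of relations up to denominators, and the values lie in a domain.\<close>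
lemma linear_on_relations_eqI:
  fixes f :: "'m::finite \<Rightarrow> ('n::linorder, 'k::field_char_0) mpoly"
  assumes B: "triangular f UNIV B"
    and lin: "linear_on_relations f \<phi>" "linear_on_relations f \<psi>"
    and eq: "\<And>F. F \<in> snd ` set B \<Longrightarrow> \<phi> F = \<psi> F" and F: "F \<in> rel_ideal f"
  shows "\<phi> F = \<psi> F"
proof -
  have piv: "pivoted f B" using B unfolding triangular_def by simp
  have comb: "\<phi> H = \<psi> H" if "H \<in> combinations Fs" "set Fs \<subseteq> snd ` set B" for H Fs
    using that
  proof (induction Fs arbitrary: H)
    case Nil
    have "\<phi> (0 * F) = subst f 0 * \<phi> F" "\<psi> (0 * F) = subst f 0 * \<psi> F"
      using lin F unfolding linear_on_relations_def by blast+
    with Nil show ?case by simp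
  next
    case (Cons G Fs)
    have sub: "set (G # Fs) \<subseteq> rel_ideal f"
      using Cons.prems(2) pivoted_rel_ideal[OF piv] by (rule subset_trans)
    obtain Q K where H: "H = Q * G + K" "K \<in> combinations Fs"
      using Cons.prems(1) by (rule combinations_ConsE)
    have "K \<in> rel_ideal f" "G \<in> rel_ideal f"
      using combinations_rel_ideal[OF _ H(2)] sub by auto
    moreover have "\<phi> K = \<psi> K" "\<phi> G = \<psi> G" using Cons H(2) eq by auto
    ultimately show ?case
      using lin rel_ideal_smult[of G f Q] unfolding H(1) linear_on_relations_def by simp
  qed
  have "F \<in> saturation f (map snd B)"
    using triangularD[OF B polys_in_UNIV] F unfolding rel_ideal_def by blast
  then obtain s where s: "subst f s \<noteq> 0" "s * F \<in> combinations (map snd B)"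
    by (rule saturationE)
  have "\<phi> (s * F) = \<psi> (s * F)" using comb[OF s(2)] by simp
  then have "subst f s * \<phi> F = subst f s * \<psi> F"
    using lin F unfolding linear_on_relations_def by simp
  with s(1) show ?thesis by simp
qed

lemma linear_on_relations_row:
  "linear_on_relations f (\<lambda>F. \<Sum>j\<in>UNIV. \<xi> j * delta_rep f F j)"
  unfolding linear_on_relations_def
  by (auto simp: delta_rep_add delta_rep_mult rel_ideal_def algebra_simps sum.distrib sum_distrib_left)

text \<open>Over the field of fractions of \<open>A\<close>, a linear function of a relation is a linear form in its
  gradient: such a form can be chosen with the right values on a triangular system.\<close>
lemma functional_extends:
  fixes f :: "'m::finite \<Rightarrow> ('n::linorder, 'k::field_char_0) mpoly"
  assumes "linear_on_relations f \<phi>" "\<phi> ` rel_ideal f \<subseteq> range (subst f)"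
  shows "\<exists>s\<in>range (subst f). \<exists>\<xi>. s \<noteq> 0 \<and> range \<xi> \<subseteq> range (subst f) \<and>
    (\<forall>F\<in>rel_ideal f. (\<Sum>j\<in>UNIV. \<xi> j * delta_rep f F j) = s * \<phi> F)"
proof -
  obtain B where B: "triangular f UNIV B" by (rule triangular_system)
  then have piv: "pivoted f B" unfolding triangular_def by simp
  have "\<phi> F \<in> range (subst f)" if "F \<in> snd ` set B" for F
    using assms(2) pivoted_rel_ideal[OF piv] that by blast
  moreover have "range (\<lambda>_. 0) \<subseteq> range (subst f)"
    using range_subst_closed(1)[of f] by auto
  ultimately obtain s \<xi> where s: "s \<in> range (subst f)" "s \<noteq> 0" and \<xi>: "range \<xi> \<subseteq> range (subst f)"
    "\<forall>F\<in>snd ` set B. (\<Sum>j\<in>UNIV. \<xi> j * delta_rep f F j) = s * \<phi> F"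
    using prescribe_values[OF piv, of \<phi> "\<lambda>_. 0"] by blast
  have "linear_on_relations f (\<lambda>F. s * \<phi> F)"
    using assms(1) unfolding linear_on_relations_def by (simp add: algebra_simps)
  from linear_on_relations_eqI[OF B linear_on_relations_row this bspec[OF \<xi>(2)]]
  have "\<forall>F\<in>rel_ideal f. (\<Sum>j\<in>UNIV. \<xi> j * delta_rep f F j) = s * \<phi> F"
    by simp
  then show ?thesis using s \<xi>(1) by (intro bexI[of _ s] exI[of _ \<xi>]) simp_all
qed

text \<open>The double annihilator of the image of \<open>\<delta>\<close>, over the fractions of \<open>A\<close>. By elimination a
  multiple of \<open>w\<close> may be changed into a row that vanishes at the pivots. At another index \<open>i\<close>
  that row vanishes as well, since there is a linear form that kills the image of \<open>\<delta>\<close> and sees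
  only the entry \<open>i\<close> among those that are not pivots.\<close>
lemma double_annihilator:
  fixes f :: "'m::finite \<Rightarrow> ('n::linorder, 'k::field_char_0) mpoly"
  assumes w: "range w \<subseteq> range (subst f)"
    and ann: "\<And>\<xi>. range \<xi> \<subseteq> range (subst f) \<Longrightarrow> (\<And>F. F \<in> rel_ideal f \<Longrightarrow> (\<Sum>j\<in>UNIV. \<xi> j * delta_rep f F j) = 0)
      \<Longrightarrow> (\<Sum>j\<in>UNIV. \<xi> j * w j) = 0"
  shows "\<exists>p. \<exists>H\<in>rel_ideal f. subst f p \<noteq> 0 \<and> (\<forall>j. subst f p * w j = delta_rep f H j)"
proof -
  obtain B where B: "triangular f UNIV B" by (rule triangular_system)
  then have piv: "pivoted f B" unfolding triangular_def by simp
  obtain p H where p: "subst f p \<noteq> 0" and H: "H \<in> combinations (map snd B)"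
    and l: "\<forall>l\<in>fst ` set B. subst f p * w l = subst f (pd l H)"
    using clear_pivots[OF piv w] by blast
  have H_rel: "H \<in> rel_ideal f"
    using combinations_rel_ideal[OF _ H] pivoted_rel_ideal[OF piv] by simp
  have "subst f p * w i = delta_rep f H i" for i
  proof (cases "i \<in> fst ` set B")
    case True
    then show ?thesis using bspec[OF l True] by (simp add: delta_rep_def)
  next
    case False
    have "range (\<lambda>j. if j = i then 1 else 0) \<subseteq> range (subst f)"
      by (auto intro: range_subst_closed)
    from prescribe_values[OF piv _ this, of "\<lambda>_. 0"] obtain s \<xi> where s: "s \<noteq> 0" and \<xi>: "range \<xi> \<subseteq> range (subst f)"
      "\<forall>F\<in>snd ` set B. (\<Sum>j\<in>UNIV. \<xi> j * delta_rep f F j) = 0"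
      "\<forall>j. j \<notin> fst ` set B \<longrightarrow> \<xi> j = s * (if j = i then 1 else 0)"
      using range_subst_closed(1)[of f] by auto
    have "linear_on_relations f (\<lambda>F. 0)" by (simp add: linear_on_relations_def)
    from linear_on_relations_eqI[OF B linear_on_relations_row this bspec[OF \<xi>(2)]]
    have perp: "(\<Sum>j\<in>UNIV. \<xi> j * delta_rep f F j) = 0" if "F \<in> rel_ideal f" for F
      using that by simp
    have "(\<Sum>j\<in>UNIV. \<xi> j * (subst f p * w j - delta_rep f H j))
        = subst f p * (\<Sum>j\<in>UNIV. \<xi> j * w j) - (\<Sum>j\<in>UNIV. \<xi> j * delta_rep f H j)"
      by (simp add: algebra_simps sum_subtractf sum_distrib_left)
    also have "\<dots> = 0" using ann[OF \<xi>(1) perp] perp[OF H_rel] by simp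
    finally have "(\<Sum>j\<in>UNIV. \<xi> j * (subst f p * w j - delta_rep f H j)) = 0" .
    moreover have "\<xi> j * (subst f p * w j - delta_rep f H j)
        = (if i = j then s * (subst f p * w j - delta_rep f H j) else 0)" for j
    proof (cases "j \<in> fst ` set B")
      case True
      then show ?thesis using False bspec[OF l True] by (auto simp: delta_rep_def)
    next
      case False
      then show ?thesis using \<xi>(3) by auto
    qed
    ultimately show ?thesis using s by simp
  qed
  with p H_rel show ?thesis by blast
qed

section \<open>The conormal map and the kernel of the Jacobian\<close>

text \<open>Injectivity of \<open>\<delta>\<close>: up to a denominator outside $P$ a relation is a combination of a triangular
  system, and if its gradient vanishes on the variety, the coefficients of the combination lie in $P$.\<close>
lemma rel_ideal2_if_delta_rep_0:
  fixes f :: "'m::finite \<Rightarrow> ('n::linorder, 'k::field_char_0) mpoly"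
  assumes F: "F \<in> rel_ideal f" "delta_rep f F = (\<lambda>_. 0)"
  shows "F \<in> rel_ideal2 f"
proof -
  obtain B where B: "triangular f UNIV B" by (rule triangular_system)
  have "F \<in> saturation f (map snd B)"
    using triangularD[OF B polys_in_UNIV] F(1) unfolding rel_ideal_def by blast
  then obtain s where s: "subst f s \<noteq> 0" "s * F \<in> combinations (map snd (B @ []))"
    by (elim saturationE) simp
  have "\<forall>l. subst f (pd l (s * F)) = 0"
    using F by (auto simp: pd_mult subst_add subst_mult rel_ideal_def delta_rep_def fun_eq_iff)
  with eliminate_pivots[OF _ s(2)] B have "s * F \<in> ideal_prod poly_ring (rel_ideal f) (rel_ideal f)"
    unfolding triangular_def by auto
  moreover have "s \<notin> rel_ideal f" using s(1) by (simp add: rel_ideal_def)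
  ultimately show ?thesis unfolding rel_ideal2_iff by blast
qed

text \<open>The kernel of the Jacobian on \<open>A\<close>-rows exceeds the image of \<open>\<delta>\<close> only by torsion.
  This is the injectivity of $K \otimes \Omega_{A/k} \to \Omega_{L/k}$ for the fields of fractions
  $K \subset L$ of $A \subset R$ in characteristic zero, proved without extending derivations. The tuple
  \<open>g\<close> consists of the $f_j$ and the $x_i$; among its relations are the $T_j - f_j(x)$, and
  \<open>G\<close> is the combination of these with coefficients $v_j$. Its gradient is \<open>v\<close> in the
  directions $T_j$ and the negative of the Jacobian applied to \<open>v\<close>, hence 0, in the directions
  $x_i$. In a triangular system in which the variables $T_j$ come before the $x_i$, the relations with a
  pivot $x_i$ can therefore be eliminated: a multiple of \<open>v\<close> by an element of \<open>R\<close> is a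
  combination over \<open>R\<close> of gradients of relations of \<open>f\<close>. Elimination over \<open>A\<close> shows that the
  multiplier and the coefficients may be taken in \<open>A\<close>.\<close>
lemma jacobian_kernel_torsion:
  fixes f :: "'m::finite \<Rightarrow> ('n::{finite,linorder}, 'k::field_char_0) mpoly"
  assumes v: "range v \<subseteq> range (subst f)" and jac: "jac_map f v = (\<lambda>_. 0)"
  shows "\<exists>p. \<exists>H\<in>rel_ideal f. subst f p \<noteq> 0 \<and> (\<forall>j. subst f p * v j = delta_rep f H j)"
proof -
  define g :: "'m + 'n \<Rightarrow> ('n, 'k) mpoly" where "g = case_sum f mvar"
  define \<iota> where "\<iota> = subst (\<lambda>j. mvar (Inl j :: 'm + 'n) :: ('m + 'n, 'k) mpoly)"
  define \<kappa> where "\<kappa> = subst (\<lambda>i. mvar (Inr i :: 'm + 'n) :: ('m + 'n, 'k) mpoly)"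
  have g_\<iota>: "subst g (\<iota> F) = subst f F" and g_\<kappa>: "subst g (\<kappa> q) = q" for F q
    by (simp_all add: \<iota>_def \<kappa>_def subst_subst g_def subst_mvar_id)
  have pd_\<iota>: "pd (Inl j) (\<iota> F) = \<iota> (pd j F)" "pd (Inr i) (\<iota> F) = 0" for i j F
    by (simp_all add: \<iota>_def chain_rule pd_mvar if_distrib cong: if_cong)
  have pd_\<kappa>: "pd (Inr i) (\<kappa> q) = \<kappa> (pd i q)" "pd (Inl j) (\<kappa> q) = 0" for i j q
    by (simp_all add: \<kappa>_def chain_rule pd_mvar if_distrib cong: if_cong)
  \<comment> \<open>The image of \<open>\<iota>\<close> consists of the polynomials in the $T_j$ alone; thus a triangular system for
    \<open>f\<close> is one for \<open>g\<close> in these variables.\<close>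
  have \<iota>_in: "\<iota> F \<in> polys_in (range Inl)" for F
  proof (induction F rule: mpoly_induct)
    case (var v)
    then show ?case by (simp add: \<iota>_def polys_in.var flip: mvar_def del: One_nat_def)
  qed (auto simp: \<iota>_def subst_const subst_add subst_mult intro: polys_in.intros)
  have \<iota>_onto: "F \<in> range \<iota>" if "F \<in> polys_in (range Inl)" for F
    using that
  proof induction
    case (const c)
    have "Poly_Mapping.single 0 c = \<iota> (Poly_Mapping.single 0 c)" by (simp add: \<iota>_def subst_const)
    then show ?case by (rule range_eqI)
  next
    case (var v)
    then obtain j where "v = Inl j" by blast
    then have "mvar v = \<iota> (mvar j)" by (simp add: \<iota>_def)
    then show ?case by (rule range_eqI)
  next
    case (add F G)
    then show ?case unfolding \<iota>_def by (rule_tac range_subst_closed)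
  next
    case (mult F G)
    then show ?case unfolding \<iota>_def by (rule_tac range_subst_closed)
  qed

  obtain B where B: "triangular f UNIV B" by (rule triangular_system)
  then have piv: "pivoted f B" unfolding triangular_def by simp
  define B' where "B' = map (map_prod (Inl :: 'm \<Rightarrow> 'm + 'n) \<iota>) B"
  have snd_B': "map snd B' = map \<iota> (map snd B)"
    by (simp add: B'_def)
  have "pivoted g (map (map_prod (Inl :: 'm \<Rightarrow> 'm + 'n) \<iota>) C)" if "pivoted f C" for C
    using that by (induction C) (auto simp: g_\<iota> pd_\<iota>, simp add: \<iota>_def)
  from this[OF piv] have piv': "pivoted g B'" by (simp add: B'_def)
  have "triangular g (range Inl) B'"
    unfolding triangular_def
  proof (intro conjI piv' subsetI)
    fix F assume "F \<in> snd ` set B'"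
    then show "F \<in> polys_in (range Inl)" by (auto simp: B'_def \<iota>_in)
  next
    fix F assume F: "F \<in> polys_in (range Inl) \<inter> rel_ideal g"
    then obtain F' where F': "F = \<iota> F'" using \<iota>_onto by blast
    with F have "subst f F' = 0" by (simp add: rel_ideal_def g_\<iota>)
    then obtain s where s: "subst f s \<noteq> 0" "s * F' \<in> combinations (map snd B)"
      using saturationE[OF triangularD[OF B polys_in_UNIV]] by blast
    have "\<iota> s * F \<in> combinations (map snd B')"
      using combinations_subst[OF s(2), of "\<lambda>j. mvar (Inl j)"]
      unfolding snd_B' F' \<iota>_def by (simp only: subst_mult)
    with s(1) show "F \<in> saturation g (map snd B')"
      by (intro saturationI[of g "\<iota> s"]) (simp_all add: g_\<iota>)
  qed
  moreover have "range Inl \<inter> range Inr = ({} :: ('m + 'n) set)" by auto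
  ultimately obtain C where C: "fst ` set C \<subseteq> range Inr" and tri: "triangular g UNIV (C @ B')"
    using add_variables[of "range Inr" g "range Inl" B'] by (auto simp: UNIV_sum)

  have "\<exists>V. \<forall>j. v j = subst f (V j)" using v by (intro choice) blast
  then obtain V where V: "\<And>j. v j = subst f (V j)" by blast
  define G where "G = (\<Sum>j\<in>UNIV. \<iota> (V j) * (mvar (Inl j) - \<kappa> (f j)))"
  have g_0: "subst g (mvar (Inl j) - \<kappa> (f j)) = 0" for j
    by (simp add: subst_diff g_\<kappa>) (simp add: g_def)
  then have G_rel: "subst g G = 0"
    by (simp add: G_def subst_sum subst_mult)
  have pd_G: "subst g (pd l G) = (\<Sum>j\<in>UNIV. v j * subst g (pd l (mvar (Inl j) - \<kappa> (f j))))" for l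
    by (simp add: G_def pd_sum subst_sum pd_mult subst_add subst_mult g_0 g_\<iota> V)
  have "subst g (pd (Inl i) G) = (\<Sum>j\<in>UNIV. if i = j then v j else 0)" for i
    unfolding pd_G by (intro sum.cong) (auto simp: pd_diff pd_mvar pd_\<kappa>)
  then have pd_G_Inl: "subst g (pd (Inl i) G) = v i" for i by simp
  have "subst g (pd (Inr i) G) = - jac_map f v i" for i
    unfolding pd_G by (simp add: pd_diff pd_mvar pd_\<kappa> subst_uminus g_\<kappa> jac_map_def grad_def sum_negf)
  then have pd_G_Inr: "subst g (pd (Inr i) G) = 0" for i by (simp add: jac)

  have "G \<in> saturation g (map snd (C @ B'))"
    using triangularD[OF tri polys_in_UNIV G_rel] .
  then obtain s where s: "subst g s \<noteq> 0" "s * G \<in> combinations (map snd (C @ B'))"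
    by (rule saturationE)
  have pd_sG: "subst g (pd l (s * G)) = subst g s * subst g (pd l G)" for l
    by (simp add: pd_mult subst_add subst_mult G_rel)
  have "\<forall>l\<in>fst ` set C. subst g (pd l (s * G)) = 0"
    using C by (auto simp: pd_sG pd_G_Inr)
  moreover have "pivoted g (C @ B')" using tri unfolding triangular_def by simp
  ultimately obtain H where H: "H \<in> combinations (map snd B')"
    "s * G - H \<in> ideal_prod poly_ring (rel_ideal g) (rel_ideal g)"
    using eliminate_pivots[OF _ s(2)] by auto
  have pd_H: "subst g (pd (Inl i) H) = subst g s * v i" for i
    using delta_rep_ideal_prod[OF H(2), of "Inl i"] pd_sG[of "Inl i"] pd_G_Inl[of i]
    by (simp add: pd_diff subst_diff)

  obtain p K where p: "subst f p \<noteq> 0" and K: "K \<in> combinations (map snd B)"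
    and l: "\<forall>l\<in>fst ` set B. subst f p * v l = subst f (pd l K)"
    using clear_pivots[OF piv v] by blast
  have K': "\<iota> K \<in> combinations (map snd B')"
    using combinations_subst[OF K] unfolding snd_B' \<iota>_def .
  have rel: "subst g H = 0" "subst f K = 0" "K \<in> rel_ideal f"
    using combinations_rel_ideal[OF _ H(1)] pivoted_rel_ideal[OF piv']
      combinations_rel_ideal[OF _ K] pivoted_rel_ideal[OF piv] by (auto simp: rel_ideal_def)
  \<comment> \<open>Up to factors, both \<open>H\<close> and \<open>\<iota> K\<close> have the gradient \<open>v\<close> at the pivots, so their
    difference has gradient 0 at the pivots and by elimination everywhere.\<close>
  define L where "L = \<iota> p * H - s * \<iota> K"
  have pd_L: "subst g (pd (Inl i) L) = subst g s * (subst f p * v i - subst f (pd i K))" for i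
    by (simp add: L_def pd_diff pd_add pd_mult subst_diff subst_add subst_mult rel pd_H g_\<iota> pd_\<iota> algebra_simps)
  have L: "L \<in> combinations (map snd (B' @ []))"
    using combinations_add[OF combinations_mult[OF H(1), of "\<iota> p"] combinations_mult[OF K', of "- s"]]
    by (simp add: L_def)
  have "\<forall>l\<in>fst ` set B'. subst g (pd l L) = 0"
    using l by (auto simp: B'_def pd_L)
  with eliminate_pivots[OF _ L] piv' have "L \<in> ideal_prod poly_ring (rel_ideal g) (rel_ideal g)"
    by auto
  then have "subst g s * (subst f p * v i - subst f (pd i K)) = 0" for i
    using delta_rep_ideal_prod[of L g "Inl i"] unfolding pd_L by blast
  then have "subst f p * v i = delta_rep f K i" for i
    using s(1) by (simp add: delta_rep_def)
  with p rel(3) show ?thesis by blast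
qed

section \<open>Reflexivity\<close>

text \<open>The biduality map sends \<open>x\<close> to a functional that knows the coordinates of \<open>x\<close>. Conversely, a
  functional \<open>\<Phi>\<close> on the dual has the coordinates \<open>w j = \<Phi> (\<pi> j)\<close>, and these satisfy every linear
  relation between the \<open>\<pi> j\<close>; so by the last hypothesis they are the coordinates of an element
  \<open>x\<close>. As every linear form is, up to a factor, a combination of coordinates, \<open>\<Phi>\<close> is evaluation
  at \<open>x\<close>.\<close>
lemma reflexive_if_coordinates:
  fixes S :: "'a::idom set" and M :: "('a, 'b) module" and \<pi> :: "'j::finite \<Rightarrow> 'b \<Rightarrow> 'a"
  defines "R \<equiv> class_ring S"
  assumes M: "module R M"
    and \<pi>: "\<And>j. \<pi> j \<in> module_hom R M (self_module R)"
    and inj: "\<And>x y. x \<in> carrier M \<Longrightarrow> y \<in> carrier M \<Longrightarrow> (\<And>j. \<pi> j x = \<pi> j y) \<Longrightarrow> x = y"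
    and ext: "\<And>\<phi>. \<phi> \<in> module_hom R M (self_module R) \<Longrightarrow>
      \<exists>s\<in>S. \<exists>\<xi>. s \<noteq> 0 \<and> range \<xi> \<subseteq> S \<and> (\<forall>x\<in>carrier M. (\<Sum>j\<in>UNIV. \<xi> j * \<pi> j x) = s * \<phi> x)"
    and ann: "\<And>w. range w \<subseteq> S \<Longrightarrow>
      (\<And>\<xi>. range \<xi> \<subseteq> S \<Longrightarrow> (\<And>x. x \<in> carrier M \<Longrightarrow> (\<Sum>j\<in>UNIV. \<xi> j * \<pi> j x) = 0) \<Longrightarrow> (\<Sum>j\<in>UNIV. \<xi> j * w j) = 0) \<Longrightarrow>
      \<exists>x\<in>carrier M. \<forall>j. w j = \<pi> j x"
  shows "reflexive R M"
proof -
  interpret M: module R M by (rule M)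
  have ops: "carrier R = S" "a \<oplus>\<^bsub>R\<^esub> b = a + b" "a \<otimes>\<^bsub>R\<^esub> b = a * b" "\<zero>\<^bsub>R\<^esub> = 0" for a b
    by (simp_all add: R_def class_ring_def)
  have S: "0 \<in> S" "a \<in> S \<Longrightarrow> b \<in> S \<Longrightarrow> a + b \<in> S" "a \<in> S \<Longrightarrow> b \<in> S \<Longrightarrow> a * b \<in> S" for a b
    using M.R.zero_closed M.R.a_closed[of a b] M.R.m_closed[of a b] by (simp_all add: ops)
  define forms where "forms = carrier (dual_module R M)"
  define lin where "lin \<xi> J = (\<lambda>x\<in>carrier M. \<Sum>j\<in>J. \<xi> j * \<pi> j x)" for \<xi> :: "'j \<Rightarrow> 'a" and J
  have formsI: "restrict \<phi> (carrier M) \<in> forms"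
    if "\<And>x. x \<in> carrier M \<Longrightarrow> \<phi> x \<in> S" "\<And>x y. x \<in> carrier M \<Longrightarrow> y \<in> carrier M \<Longrightarrow> \<phi> (x \<oplus>\<^bsub>M\<^esub> y) = \<phi> x + \<phi> y"
      "\<And>a x. a \<in> S \<Longrightarrow> x \<in> carrier M \<Longrightarrow> \<phi> (a \<odot>\<^bsub>M\<^esub> x) = a * \<phi> x" for \<phi>
    using that by (auto simp: forms_def dual_module_def module_hom_def self_module_def ops)
  have homD: "\<phi> x \<in> S" "y \<in> carrier M \<Longrightarrow> \<phi> (x \<oplus>\<^bsub>M\<^esub> y) = \<phi> x + \<phi> y" "a \<in> S \<Longrightarrow> \<phi> (a \<odot>\<^bsub>M\<^esub> x) = a * \<phi> x"
    if "\<phi> \<in> module_hom R M (self_module R)" "x \<in> carrier M" for \<phi> x y a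
    using that by (auto simp: module_hom_def self_module_def ops)
  have forms_hom: "\<phi> \<in> module_hom R M (self_module R)" "\<phi> \<in> extensional (carrier M)" if "\<phi> \<in> forms" for \<phi>
    using that by (simp_all add: forms_def dual_module_def)
  have add: "\<phi> \<oplus>\<^bsub>dual_module R M\<^esub> \<psi> = (\<lambda>x\<in>carrier M. \<phi> x + \<psi> x)"
    and smult: "a \<odot>\<^bsub>dual_module R M\<^esub> \<phi> = (\<lambda>x\<in>carrier M. a * \<phi> x)" for \<phi> \<psi> a
    by (simp_all add: dual_module_def ops)
  have forms_add: "(\<lambda>x\<in>carrier M. \<phi> x + \<psi> x) \<in> forms" if "\<phi> \<in> forms" "\<psi> \<in> forms" for \<phi> \<psi>
    using homD[OF forms_hom(1)[OF that(1)]] homD[OF forms_hom(1)[OF that(2)]]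
    by (intro formsI) (simp_all add: S algebra_simps)
  have forms_smult: "(\<lambda>x\<in>carrier M. a * \<phi> x) \<in> forms" if "a \<in> S" "\<phi> \<in> forms" for a \<phi>
    using homD[OF forms_hom(1)[OF that(2)]] that(1) by (intro formsI) (simp_all add: S algebra_simps)
  have coord: "restrict (\<pi> j) (carrier M) \<in> forms" for j
    using homD[OF \<pi>] by (intro formsI) simp_all
  have bidualI: "(\<lambda>\<phi>\<in>forms. \<phi> x) \<in> carrier (dual_module R (dual_module R M))" if x: "x \<in> carrier M" for x
  proof -
    have "(\<lambda>\<phi>\<in>forms. \<phi> x) \<in> module_hom R (dual_module R M) (self_module R)"
      unfolding module_hom_def add smult forms_def[symmetric]
      using x homD[OF forms_hom(1)] forms_add forms_smult by (auto simp: self_module_def ops)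
    then show ?thesis by (simp add: dual_module_def[of R "dual_module R M"] forms_def)
  qed
  have onto: "\<exists>x\<in>carrier M. \<Phi> = (\<lambda>\<phi>\<in>forms. \<phi> x)" if \<Phi>: "\<Phi> \<in> carrier (dual_module R (dual_module R M))" for \<Phi>
  proof -
    have hom: "\<Phi> \<in> module_hom R (dual_module R M) (self_module R)" and \<Phi>_ext: "\<Phi> \<in> extensional forms"
      using \<Phi> by (simp_all add: dual_module_def[of R "dual_module R M"] forms_def)
    have \<Phi>_S: "\<Phi> \<phi> \<in> S" if "\<phi> \<in> forms" for \<phi>
      using hom that by (auto simp: module_hom_def self_module_def ops forms_def)
    have \<Phi>_add: "\<Phi> (\<lambda>x\<in>carrier M. \<phi> x + \<psi> x) = \<Phi> \<phi> + \<Phi> \<psi>" if "\<phi> \<in> forms" "\<psi> \<in> forms" for \<phi> \<psi>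
      using hom that unfolding module_hom_def add forms_def[symmetric] by (auto simp: self_module_def ops)
    have \<Phi>_smult: "\<Phi> (\<lambda>x\<in>carrier M. a * \<phi> x) = a * \<Phi> \<phi>" if "a \<in> S" "\<phi> \<in> forms" for a \<phi>
      using hom that unfolding module_hom_def smult forms_def[symmetric] by (auto simp: self_module_def ops)
    define w where "w j = \<Phi> (restrict (\<pi> j) (carrier M))" for j
    have \<Phi>_lin: "lin \<xi> J \<in> forms \<and> \<Phi> (lin \<xi> J) = (\<Sum>j\<in>J. \<xi> j * w j)" if "range \<xi> \<subseteq> S" for \<xi> J
    proof (induction J rule: infinite_finite_induct)
      case (insert i J)
      have i: "(\<lambda>x\<in>carrier M. \<xi> i * restrict (\<pi> i) (carrier M) x) \<in> forms"
        "\<Phi> (\<lambda>x\<in>carrier M. \<xi> i * restrict (\<pi> i) (carrier M) x) = \<xi> i * w i"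
        using \<Phi>_smult[OF _ coord, of "\<xi> i" i] forms_smult[OF _ coord, of "\<xi> i" i] that
        by (auto simp only: w_def image_subset_iff)
      have eq: "lin \<xi> (insert i J) = (\<lambda>x\<in>carrier M. (\<lambda>x\<in>carrier M. \<xi> i * restrict (\<pi> i) (carrier M) x) x + lin \<xi> J x)"
        using insert.hyps by (auto simp: lin_def fun_eq_iff)
      have J: "lin \<xi> J \<in> forms" using insert.IH ..
      have "lin \<xi> (insert i J) \<in> forms" unfolding eq by (rule forms_add[OF i(1) J])
      moreover have "\<Phi> (lin \<xi> (insert i J)) = \<xi> i * w i + \<Phi> (lin \<xi> J)"
        unfolding eq \<Phi>_add[OF i(1) J] i(2) ..
      ultimately show ?case using insert by simp
    next
      case empty
      have eq: "lin \<xi> {} = (\<lambda>x\<in>carrier M. 0 * restrict (\<pi> undefined) (carrier M) x)"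
        by (simp add: lin_def)
      have "lin \<xi> {} \<in> forms" unfolding eq by (rule forms_smult[OF S(1) coord])
      moreover have "\<Phi> (lin \<xi> {}) = 0" unfolding eq \<Phi>_smult[OF S(1) coord] by simp
      ultimately show ?case by simp
    next
      case (infinite J)
      then show ?case by simp
    qed
    have "\<exists>x\<in>carrier M. \<forall>j. w j = \<pi> j x"
    proof (rule ann)
      show "range w \<subseteq> S" using \<Phi>_S[OF coord] by (auto simp: w_def)
    next
      fix \<xi> :: "'j \<Rightarrow> 'a" assume \<xi>: "range \<xi> \<subseteq> S" "\<And>x. x \<in> carrier M \<Longrightarrow> (\<Sum>j\<in>UNIV. \<xi> j * \<pi> j x) = 0"
      then have "lin \<xi> UNIV = lin (\<lambda>_. 0) {}" by (auto simp: lin_def fun_eq_iff)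
      then show "(\<Sum>j\<in>UNIV. \<xi> j * w j) = 0"
        using \<Phi>_lin[OF \<xi>(1), of UNIV] \<Phi>_lin[of "\<lambda>_. 0" "{}"] S(1) by simp
    qed
    then obtain x where x: "x \<in> carrier M" "\<And>j. w j = \<pi> j x" by blast
    have "\<Phi> \<phi> = \<phi> x" if \<phi>: "\<phi> \<in> forms" for \<phi>
    proof -
      obtain s \<xi> where s: "s \<in> S" "s \<noteq> 0" and \<xi>: "range \<xi> \<subseteq> S"
        "\<forall>x\<in>carrier M. (\<Sum>j\<in>UNIV. \<xi> j * \<pi> j x) = s * \<phi> x"
        using ext[OF forms_hom(1)[OF \<phi>]] by blast
      have "lin \<xi> UNIV = (\<lambda>x\<in>carrier M. s * \<phi> x)" using \<xi>(2) by (auto simp: lin_def fun_eq_iff)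
      then have "s * \<Phi> \<phi> = (\<Sum>j\<in>UNIV. \<xi> j * w j)"
        using \<Phi>_lin[OF \<xi>(1), of UNIV] \<Phi>_smult[OF s(1) \<phi>] by simp
      also have "\<dots> = s * \<phi> x" using \<xi>(2) x by simp
      finally show ?thesis using s(2) by simp
    qed
    then have "\<Phi> = (\<lambda>\<phi>\<in>forms. \<phi> x)"
      using \<Phi>_ext by (intro extensionalityI[of _ forms]) auto
    with x(1) show ?thesis by blast
  qed
  have "inj_on (\<lambda>x. \<lambda>\<phi>\<in>forms. \<phi> x) (carrier M)"
  proof (rule inj_onI)
    fix x y assume x: "x \<in> carrier M" and y: "y \<in> carrier M" and eq: "(\<lambda>\<phi>\<in>forms. \<phi> x) = (\<lambda>\<phi>\<in>forms. \<phi> y)"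
    show "x = y"
    proof (rule inj[OF x y])
      show "\<pi> j x = \<pi> j y" for j
        using fun_cong[OF eq, of "restrict (\<pi> j) (carrier M)"] coord x y by simp
    qed
  qed
  then show ?thesis
    unfolding reflexive_def forms_def[symmetric] bij_betw_def using bidualI onto by blast
qed

lemma carrier_subalg: "carrier (subalg f) = range (subst f)"
  by (simp add: subalg_def class_ring_def)

lemma carrier_free_subalg: "carrier (free_module (subalg f)) = {v. range v \<subseteq> range (subst f)}"
  by (auto simp: free_module_def carrier_subalg)

text \<open>The coordinates are those of \<open>\<delta>\<close>. A row that satisfies all linear relations between them lies
  in the image of \<open>\<delta>\<close> up to a denominator, and the hypothesis, that the cokernel of
  \<open>\<delta>\<close> has no torsion, removes the denominator.\<close>
lemma reflexive_conormal:
  fixes f :: "'m::finite \<Rightarrow> ('n::linorder, 'k::field_char_0) mpoly"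
  assumes sat: "\<And>p v. subst f p \<noteq> 0 \<Longrightarrow> range v \<subseteq> range (subst f) \<Longrightarrow>
    (\<lambda>j. subst f p * v j) \<in> delta_rep f ` rel_ideal f \<Longrightarrow> v \<in> delta_rep f ` rel_ideal f"
  shows "reflexive (subalg f) (conormal f)"
proof -
  define cls where "cls F = rel_ideal2 f +>\<^bsub>poly_ring\<^esub> F" for F
  have carrier: "carrier (conormal f) = cls ` rel_ideal f"
    unfolding carrier_conormal cls_def ..
  have delta: "delta f (cls F) = delta_rep f F" for F
    unfolding cls_def by (rule delta_coset)
  have add: "cls F \<oplus>\<^bsub>conormal f\<^esub> cls G = cls (F + G)" for F G
    unfolding cls_def by (rule conormal_add)
  have smult: "subst f Q \<odot>\<^bsub>conormal f\<^esub> cls F = cls (Q * F)" if "F \<in> rel_ideal f" for Q F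
    unfolding cls_def using that by (rule conormal_smult)
  have self: "carrier (self_module (subalg f)) = range (subst f)" "x \<oplus>\<^bsub>self_module (subalg f)\<^esub> y = x + y"
    "a \<odot>\<^bsub>self_module (subalg f)\<^esub> x = a * x" for x y a
    by (simp_all add: self_module_def subalg_def class_ring_def)
  show ?thesis
    unfolding subalg_def
  proof (rule reflexive_if_coordinates[where \<pi> = "\<lambda>j X. delta f X j"], unfold subalg_def[symmetric])
    show "module (subalg f) (conormal f)" by (rule module_conormal)
  next
    fix j
    show "(\<lambda>X. delta f X j) \<in> module_hom (subalg f) (conormal f) (self_module (subalg f))"
      unfolding module_hom_def carrier carrier_subalg self
      by (auto simp: add smult delta delta_rep_add delta_rep_mult) (auto simp: delta_rep_def rel_ideal_def)
  next
    fix X Y assume "X \<in> carrier (conormal f)" "Y \<in> carrier (conormal f)" and eq: "\<And>j. delta f X j = delta f Y j"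
    then obtain F G where FG: "F \<in> rel_ideal f" "G \<in> rel_ideal f" "X = cls F" "Y = cls G"
      unfolding carrier by blast
    have "F - G \<in> rel_ideal2 f"
    proof (rule rel_ideal2_if_delta_rep_0)
      show "F - G \<in> rel_ideal f" using FG by (simp add: rel_ideal_def subst_diff)
      show "delta_rep f (F - G) = (\<lambda>_. 0)"
        using eq by (simp add: FG delta delta_rep_def pd_diff subst_diff)
    qed
    then show "X = Y" unfolding FG cls_def by (rule coset_eq_poly_ring)
  next
    fix \<phi> assume \<phi>: "\<phi> \<in> module_hom (subalg f) (conormal f) (self_module (subalg f))"
    have lin: "linear_on_relations f (\<lambda>F. \<phi> (cls F))"
      unfolding linear_on_relations_def
    proof (intro conjI ballI allI)
      fix F G assume "F \<in> rel_ideal f" "G \<in> rel_ideal f"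
      then show "\<phi> (cls (F + G)) = \<phi> (cls F) + \<phi> (cls G)"
        using \<phi> by (simp add: module_hom_def carrier self flip: add)
    next
      fix Q F assume "F \<in> rel_ideal f"
      then show "\<phi> (cls (Q * F)) = subst f Q * \<phi> (cls F)"
        using \<phi> by (simp add: module_hom_def carrier carrier_subalg self flip: smult)
    qed
    have "(\<lambda>F. \<phi> (cls F)) ` rel_ideal f \<subseteq> range (subst f)"
      using \<phi> by (auto simp: module_hom_def carrier self)
    from functional_extends[OF lin this] obtain s \<xi> where "s \<in> range (subst f)" "s \<noteq> 0" "range \<xi> \<subseteq> range (subst f)"
      "\<forall>F\<in>rel_ideal f. (\<Sum>j\<in>UNIV. \<xi> j * delta_rep f F j) = s * \<phi> (cls F)"
      by (elim bexE exE conjE)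
    then show "\<exists>s\<in>range (subst f). \<exists>\<xi>. s \<noteq> 0 \<and> range \<xi> \<subseteq> range (subst f) \<and>
        (\<forall>X\<in>carrier (conormal f). (\<Sum>j\<in>UNIV. \<xi> j * delta f X j) = s * \<phi> X)"
      unfolding carrier by (intro bexI[of _ s] exI[of _ \<xi>]) (simp_all add: delta)
  next
    fix w assume w: "range w \<subseteq> range (subst f)"
      and ann: "\<And>\<xi>. range \<xi> \<subseteq> range (subst f) \<Longrightarrow>
        (\<And>X. X \<in> carrier (conormal f) \<Longrightarrow> (\<Sum>j\<in>UNIV. \<xi> j * delta f X j) = 0) \<Longrightarrow> (\<Sum>j\<in>UNIV. \<xi> j * w j) = 0"
    have "\<exists>p. \<exists>H\<in>rel_ideal f. subst f p \<noteq> 0 \<and> (\<forall>j. subst f p * w j = delta_rep f H j)"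
    proof (rule double_annihilator[OF w])
      fix \<xi> assume "range \<xi> \<subseteq> range (subst f)" "\<And>F. F \<in> rel_ideal f \<Longrightarrow> (\<Sum>j\<in>UNIV. \<xi> j * delta_rep f F j) = 0"
      then show "(\<Sum>j\<in>UNIV. \<xi> j * w j) = 0"
        by (intro ann) (auto simp: carrier delta)
    qed
    then obtain p H where H: "H \<in> rel_ideal f" and p: "subst f p \<noteq> 0" "\<And>j. subst f p * w j = delta_rep f H j"
      by (elim exE bexE conjE) simp
    have "(\<lambda>j. subst f p * w j) \<in> delta_rep f ` rel_ideal f"
      unfolding p(2) by (rule imageI[OF H])
    with p(1) w have "w \<in> delta_rep f ` rel_ideal f" by (rule sat)
    then obtain F where "F \<in> rel_ideal f" "w = delta_rep f F" by (rule imageE)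
    then show "\<exists>X\<in>carrier (conormal f). \<forall>j. w j = delta f X j"
      unfolding carrier by (intro bexI[of _ "cls F"]) (simp_all add: delta)
  qed
qed

section \<open>Contraction, the Leibniz map and torsion\<close>

lemma diff_syz_eq: "diff_syz f = {v. jac_map f v = (\<lambda>_. 0)}"
  by (simp add: diff_syz_def a_kernel_def' transposed_jacobian_def free_module_def class_ring_def)

lemma jac_map_delta_rep:
  assumes "F \<in> rel_ideal f" shows "jac_map f (delta_rep f F) = (\<lambda>_. 0)"
proof
  fix i
  have "jac_map f (delta_rep f F) i = pd i (subst f F)"
    by (simp add: jac_map_def delta_rep_def grad_def chain_rule)
  with assms show "jac_map f (delta_rep f F) i = 0" by (simp add: rel_ideal_def)
qed

lemma jac_map_scale: "jac_map f (\<lambda>j. a * v j) i = a * jac_map f v i"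
  by (simp add: jac_map_def sum_distrib_left mult.assoc)

lemma jac_map_diff: "jac_map f (\<lambda>j. v j - w j) i = jac_map f v i - jac_map f w i"
  by (simp add: jac_map_def sum_subtractf algebra_simps)

abbreviation kaehler_class where
  "kaehler_class f v \<equiv> (delta f ` carrier (conormal f)) +>\<^bsub>free_module (subalg f)\<^esub> v"

lemma kaehler_class_eq_iff:
  fixes f :: "'m::finite \<Rightarrow> ('n::linorder, 'k::idom) mpoly"
  shows "kaehler_class f v = kaehler_class f w \<longleftrightarrow> (\<lambda>j. v j - w j) \<in> delta_rep f ` rel_ideal f"
proof
  assume eq: "kaehler_class f v = kaehler_class f w"
  have "0 \<in> rel_ideal f" "v = (\<lambda>j. delta_rep f 0 j + v j)"
    by (simp_all add: delta_rep_def rel_ideal_def)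
  then have "v \<in> kaehler_class f v"
    unfolding coset_free_module delta_image by (intro image_eqI[OF _ imageI])
  then show "(\<lambda>j. v j - w j) \<in> delta_rep f ` rel_ideal f"
    unfolding eq unfolding coset_free_module delta_image by auto
next
  assume "(\<lambda>j. v j - w j) \<in> delta_rep f ` rel_ideal f"
  then obtain F where F: "F \<in> rel_ideal f" "(\<lambda>j. v j - w j) = delta_rep f F" by blast
  from fun_cong[OF F(2)] have "v j = delta_rep f F j + w j" for j by (simp add: algebra_simps)
  with F(1) show "kaehler_class f v = kaehler_class f w" by (rule cls_eq)
qed

lemma carrier_kaehler:
  fixes f :: "'m::finite \<Rightarrow> ('n::linorder, 'k::idom) mpoly"
  shows "carrier (kaehler f) = kaehler_class f ` {v. range v \<subseteq> range (subst f)}"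
  unfolding kaehler_carrier carrier_free_subalg[symmetric] by (simp add: free_module_def)

lemma torsion_free_kaehler_iff:
  fixes f :: "'m::finite \<Rightarrow> ('n::linorder, 'k::idom) mpoly"
  shows "torsion_free (subalg f) (kaehler f) \<longleftrightarrow>
    (\<forall>p v. subst f p \<noteq> 0 \<longrightarrow> range v \<subseteq> range (subst f) \<longrightarrow>
      (\<lambda>j. subst f p * v j) \<in> delta_rep f ` rel_ideal f \<longrightarrow> v \<in> delta_rep f ` rel_ideal f)"
proof -
  have zero: "\<zero>\<^bsub>subalg f\<^esub> = 0" by (simp add: subalg_def class_ring_def)
  have smult: "subst f p \<odot>\<^bsub>kaehler f\<^esub> kaehler_class f v = kaehler_class f (\<lambda>j. subst f p * v j)"
    if "range v \<subseteq> range (subst f)" for p v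
    using that by (intro kaehler_smult) (auto simp: carrier_subalg)
  have "torsion_free (subalg f) (kaehler f) \<longleftrightarrow>
    (\<forall>p v. range v \<subseteq> range (subst f) \<longrightarrow> subst f p \<odot>\<^bsub>kaehler f\<^esub> kaehler_class f v = \<zero>\<^bsub>kaehler f\<^esub> \<longrightarrow>
      subst f p = 0 \<or> kaehler_class f v = \<zero>\<^bsub>kaehler f\<^esub>)"
    unfolding torsion_free_def carrier_kaehler carrier_subalg zero by auto
  also have "\<dots> \<longleftrightarrow> (\<forall>p v. range v \<subseteq> range (subst f) \<longrightarrow> (\<lambda>j. subst f p * v j) \<in> delta_rep f ` rel_ideal f \<longrightarrow>
      subst f p = 0 \<or> v \<in> delta_rep f ` rel_ideal f)"
    by (simp add: smult kaehler_zero kaehler_class_eq_iff cong: imp_cong)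
  finally show ?thesis by blast
qed

lemma inj_leibniz_iff:
  fixes f :: "'m::finite \<Rightarrow> ('n::linorder, 'k::idom) mpoly"
  shows "inj_on (leibniz f) (carrier (kaehler f)) \<longleftrightarrow>
    diff_syz f \<inter> {v. range v \<subseteq> range (subst f)} \<subseteq> delta_rep f ` rel_ideal f"
proof -
  have "inj_on (leibniz f) (carrier (kaehler f)) \<longleftrightarrow>
    (\<forall>v w. range v \<subseteq> range (subst f) \<longrightarrow> range w \<subseteq> range (subst f) \<longrightarrow>
      jac_map f v = jac_map f w \<longrightarrow> (\<lambda>j. v j - w j) \<in> delta_rep f ` rel_ideal f)"
    unfolding inj_on_def carrier_kaehler by (auto simp: leibniz_coset kaehler_class_eq_iff)
  also have "\<dots> \<longleftrightarrow> diff_syz f \<inter> {v. range v \<subseteq> range (subst f)} \<subseteq> delta_rep f ` rel_ideal f"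
  proof
    assume L: "\<forall>v w. range v \<subseteq> range (subst f) \<longrightarrow> range w \<subseteq> range (subst f) \<longrightarrow>
      jac_map f v = jac_map f w \<longrightarrow> (\<lambda>j. v j - w j) \<in> delta_rep f ` rel_ideal f"
    show "diff_syz f \<inter> {v. range v \<subseteq> range (subst f)} \<subseteq> delta_rep f ` rel_ideal f"
    proof
      fix v assume v: "v \<in> diff_syz f \<inter> {v. range v \<subseteq> range (subst f)}"
      have "range (\<lambda>_. 0) \<subseteq> range (subst f)" "jac_map f (\<lambda>_. 0) = (\<lambda>_. 0)"
        using range_subst_closed(1)[of f] by (auto simp: jac_map_def)
      then show "v \<in> delta_rep f ` rel_ideal f"
        using L[rule_format, of v "\<lambda>_. 0"] v by (simp add: diff_syz_eq)
    qed
  next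
    assume R: "diff_syz f \<inter> {v. range v \<subseteq> range (subst f)} \<subseteq> delta_rep f ` rel_ideal f"
    show "\<forall>v w. range v \<subseteq> range (subst f) \<longrightarrow> range w \<subseteq> range (subst f) \<longrightarrow>
      jac_map f v = jac_map f w \<longrightarrow> (\<lambda>j. v j - w j) \<in> delta_rep f ` rel_ideal f"
    proof (intro allI impI subsetD[OF R] IntI CollectI)
      fix v w assume vw: "range v \<subseteq> range (subst f)" "range w \<subseteq> range (subst f)" "jac_map f v = jac_map f w"
      show "(\<lambda>j. v j - w j) \<in> diff_syz f"
        using vw(3) by (simp add: diff_syz_eq jac_map_diff fun_eq_iff)
      show "range (\<lambda>j. v j - w j) \<subseteq> range (subst f)"
        using vw(1,2) by (auto intro!: range_subst_closed(4) dest: range_subsetD)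
    qed
  qed
  finally show ?thesis .
qed

theorem corollary2p3:
  fixes f :: "'m::{finite,linorder} \<Rightarrow> ('n::{finite,linorder}, 'k::field_char_0) mpoly"
  assumes forms: "\<And>j. is_form (f j)"
  shows "(delta f ` carrier (conormal f) = diff_syz f \<inter> carrier (free_module (subalg f))
            \<longleftrightarrow> inj_on (leibniz f) (carrier (kaehler f)))
    \<and> (inj_on (leibniz f) (carrier (kaehler f)) \<longleftrightarrow> torsion_free (subalg f) (kaehler f))
    \<and> (delta f ` carrier (conormal f) = diff_syz f \<inter> carrier (free_module (subalg f))
          \<or> inj_on (leibniz f) (carrier (kaehler f))
          \<or> torsion_free (subalg f) (kaehler f)
        \<longrightarrow> reflexive (subalg f) (conormal f))
    \<and> (delta f ` carrier (conormal f) = polar_syz f \<inter> carrier (free_module (subalg f))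
          \<and> polarizable f
        \<longrightarrow> reflexive (subalg f) (conormal f))"
proof -
  let ?N = "delta_rep f ` rel_ideal f" and ?rows = "{v. range v \<subseteq> range (subst f)}"
  let ?contracted = "delta f ` carrier (conormal f) = diff_syz f \<inter> carrier (free_module (subalg f))"
  have "?N \<subseteq> diff_syz f \<inter> ?rows"
    by (auto simp: diff_syz_eq jac_map_delta_rep) (simp add: delta_rep_def)
  then have contracted: "?contracted \<longleftrightarrow> diff_syz f \<inter> ?rows \<subseteq> ?N"
    unfolding delta_image carrier_free_subalg by blast
  have "torsion_free (subalg f) (kaehler f) \<longleftrightarrow> diff_syz f \<inter> ?rows \<subseteq> ?N"
  proof
    assume tf: "torsion_free (subalg f) (kaehler f)"
    show "diff_syz f \<inter> ?rows \<subseteq> ?N"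
    proof
      fix v assume v: "v \<in> diff_syz f \<inter> ?rows"
      then obtain p H where p: "H \<in> rel_ideal f" "subst f p \<noteq> 0" "\<forall>j. subst f p * v j = delta_rep f H j"
        using jacobian_kernel_torsion[of v f] by (auto simp: diff_syz_eq)
      then have "(\<lambda>j. subst f p * v j) \<in> ?N" by auto
      with tf v p(2) show "v \<in> ?N" unfolding torsion_free_kaehler_iff by blast
    qed
  next
    assume N: "diff_syz f \<inter> ?rows \<subseteq> ?N"
    show "torsion_free (subalg f) (kaehler f)"
      unfolding torsion_free_kaehler_iff
    proof (intro allI impI subsetD[OF N] IntI CollectI)
      fix p v assume p: "subst f p \<noteq> 0" and "(\<lambda>j. subst f p * v j) \<in> ?N"
      then have "jac_map f (\<lambda>j. subst f p * v j) = (\<lambda>_. 0)" by (auto simp: jac_map_delta_rep)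
      with p show "v \<in> diff_syz f" by (simp add: diff_syz_eq fun_eq_iff jac_map_scale)
    qed
  qed
  moreover have refl: "reflexive (subalg f) (conormal f)" if "torsion_free (subalg f) (kaehler f)"
    using that unfolding torsion_free_kaehler_iff by (intro reflexive_conormal) blast
  ultimately show ?thesis
    unfolding contracted inj_leibniz_iff polarizable_def by (metis contracted)
qed

end
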